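(* Let $k$ be a perfect field and let $R=k\llbracket x,y\rrbracket/(y^2)$. Then $\tau_{MCM}(R)=(y)$.
   Context: All rings are commutative, unital, Noetherian and local. A maximal Cohen-Macaulay (MCM) module over a ring $R$ is a finitely generated (nonzero) $R$-module $M$ such that the length of the longest regular sequence on $M$ equals the Krull dimension of $R$; a sequence $x_1,\ldots,x_n$ in $R$ is regular on $M$ if $(x_1,\ldots,x_n)M\ne M$, $x_1$ is a non-zerodivisor on $M$, and $x_i$ is a non-zerodivisor on $M/(x_1,\ldots,x_{i-1})M$ for $2\le i\le n$. For an $R$-module $M$ and $R$-modules $A\subseteq B$, let $A_B^{\mathrm{cl}_M}=\{b\in B : x\otimes b\in \operatorname{im}(M\otimes_R A\to M\otimes_R B)\text{ for all }x\in M\}$. The test ideal of $R$ associated to $M$ is $\tau_M(R)=\bigcap_{A\subseteq B}(A:_R A_B^{\mathrm{cl}_M})$, the intersection over all pairs of $R$-modules $A\subseteq B$. By a known theorem, when $R$ is local and $M$ is finitely generated, $\tau_M(R)$ equals the trace ideal $\sum_{f\in\operatorname{Hom}_R(M,R)}f(M)$, and $\tau_M(R)$ denotes this common ideal. $\tau_{MCM}(R)=\bigcap_M \tau_M(R)$, the intersection over all isomorphism classes of maximal Cohen-Macaulay $R$-modules $M$. *)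

theory Defs
  imports "HOL-Algebra.Algebra" "HOL-Algebra.Algebraic_Closure_Type" "HOL-Library.Extended_Nat"
begin

section \<open>Modules over a commutative ring\<close>

definition submodule_span ::
    "('a, 'c) ring_scheme \<Rightarrow> ('a, 'b, 'd) module_scheme \<Rightarrow> 'b set \<Rightarrow> 'b set"
  where "submodule_span R M S = \<Inter>{N. submodule N R M \<and> S \<subseteq> N}"

definition fin_gen_module ::
    "('a, 'c) ring_scheme \<Rightarrow> ('a, 'b, 'd) module_scheme \<Rightarrow> bool"
  where "fin_gen_module R M \<longleftrightarrow>
    (\<exists>S. finite S \<and> S \<subseteq> carrier M \<and> submodule_span R M S = carrier M)"

definition mod_hom ::
    "('a, 'c) ring_scheme \<Rightarrow> ('a, 'b, 'd) module_scheme \<Rightarrow> ('a, 'e, 'f) module_scheme \<Rightarrow> ('b \<Rightarrow> 'e) set"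
  where "mod_hom R M N =
    {f \<in> hom (add_monoid M) (add_monoid N).
       \<forall>a\<in>carrier R. \<forall>m\<in>carrier M. f (a \<odot>\<^bsub>M\<^esub> m) = a \<odot>\<^bsub>N\<^esub> f m}"

definition mod_iso ::
    "('a, 'c) ring_scheme \<Rightarrow> ('a, 'b, 'd) module_scheme \<Rightarrow> ('a, 'e, 'f) module_scheme \<Rightarrow> ('b \<Rightarrow> 'e) set"
  where "mod_iso R M N = {f \<in> mod_hom R M N. bij_betw f (carrier M) (carrier N)}"

definition self_module :: "('a, 'c) ring_scheme \<Rightarrow> ('a, 'a) module"
  where "self_module R =
    \<lparr>carrier = carrier R, monoid.mult = (\<otimes>\<^bsub>R\<^esub>), one = \<one>\<^bsub>R\<^esub>,
     ring.zero = \<zero>\<^bsub>R\<^esub>, add = (\<oplus>\<^bsub>R\<^esub>), module.smult = (\<otimes>\<^bsub>R\<^esub>)\<rparr>"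

text \<open>The ring multiplication of a module record carries no meaning; it is left unspecified here.\<close>

definition quot_module :: "('a, 'b, 'd) module_scheme \<Rightarrow> 'b set \<Rightarrow> ('a, 'b set) module"
  where "quot_module M N =
    \<lparr>carrier = a_rcosets\<^bsub>M\<^esub> N, monoid.mult = undefined, one = undefined, ring.zero = N, add = set_add M,
     module.smult = (\<lambda>a C. \<Union>m\<in>C. N +>\<^bsub>M\<^esub> (a \<odot>\<^bsub>M\<^esub> m))\<rparr>"

text \<open>The submodule \<open>I M\<close> of \<open>M\<close>.\<close>

definition ideal_smult ::
    "('a, 'c) ring_scheme \<Rightarrow> ('a, 'b, 'd) module_scheme \<Rightarrow> 'a set \<Rightarrow> 'b set"
  where "ideal_smult R M I = submodule_span R M {a \<odot>\<^bsub>M\<^esub> m | a m. a \<in> I \<and> m \<in> carrier M}"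


section \<open>Maximal Cohen-Macaulay modules\<close>

definition nonzerodivisor_on :: "('a, 'b, 'd) module_scheme \<Rightarrow> 'a \<Rightarrow> bool"
  where "nonzerodivisor_on M x \<longleftrightarrow>
    (\<forall>m\<in>carrier M. x \<odot>\<^bsub>M\<^esub> m = \<zero>\<^bsub>M\<^esub> \<longrightarrow> m = \<zero>\<^bsub>M\<^esub>)"

text \<open>
  The empty sequence is regular on \<open>M\<close> exactly if \<open>M\<close> is nonzero.  For \<open>i = 0\<close> the quotient
  below is \<open>M / 0\<close>.
\<close>

definition regular_sequence ::
    "('a, 'c) ring_scheme \<Rightarrow> ('a, 'b, 'd) module_scheme \<Rightarrow> 'a list \<Rightarrow> bool"
  where "regular_sequence R M xs \<longleftrightarrow>
    set xs \<subseteq> carrier R \<and>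
    ideal_smult R M (Idl\<^bsub>R\<^esub> (set xs)) \<noteq> carrier M \<and>
    (\<forall>i<length xs.
       nonzerodivisor_on (quot_module M (ideal_smult R M (Idl\<^bsub>R\<^esub> (set (take i xs))))) (xs ! i))"

text \<open>Length of a longest regular sequence, as a supremum in the extended naturals.\<close>

definition module_depth :: "('a, 'c) ring_scheme \<Rightarrow> ('a, 'b, 'd) module_scheme \<Rightarrow> enat"
  where "module_depth R M = (SUP xs \<in> {xs. regular_sequence R M xs}. enat (length xs))"

definition krull_dim :: "('a, 'c) ring_scheme \<Rightarrow> enat"
  where "krull_dim R =
    Sup {enat n | n. \<exists>P :: nat \<Rightarrow> 'a set.
           (\<forall>i\<le>n. primeideal (P i) R) \<and> (\<forall>i<n. P i \<subset> P (Suc i))}"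

definition MCM_module :: "('a, 'c) ring_scheme \<Rightarrow> ('a, 'b, 'd) module_scheme \<Rightarrow> bool"
  where "MCM_module R M \<longleftrightarrow>
    module R M \<and> fin_gen_module R M \<and> carrier M \<noteq> {\<zero>\<^bsub>M\<^esub>} \<and> module_depth R M = krull_dim R"


section \<open>Test ideals\<close>

text \<open>
  For a finitely generated module \<open>M\<close> over a local ring \<open>R\<close>, the test ideal \<open>\<tau>\<^sub>M(R)\<close> of the
  closure \<open>cl\<^sub>M\<close> coincides with the trace ideal, the sum of the ideals \<open>f(M)\<close> over all
  \<open>f \<in> Hom\<^sub>R(M, R)\<close>; here \<open>\<tau>\<^sub>M(R)\<close> stands for the trace ideal.
\<close>

definition tau ::
    "('a, 'c) ring_scheme \<Rightarrow> ('a, 'b, 'd) module_scheme \<Rightarrow> 'a set"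
  where "tau R M = Idl\<^bsub>R\<^esub> (\<Union>f\<in>mod_hom R M (self_module R). f ` carrier M)"

text \<open>
  The intersection over all isomorphism classes of maximal Cohen-Macaulay modules.  A quantifier
  over modules has to fix the type of their elements; \<open>'a list\<close> is large enough for every
  isomorphism class of finitely generated modules to occur (lemma \<open>fin_gen_module_copy\<close>), so
  that the intersection really covers maximal Cohen-Macaulay modules of every type (lemma
  \<open>tau_MCM_subset_tau\<close>).
\<close>

definition tau_MCM :: "('a, 'c) ring_scheme \<Rightarrow> 'a set"
  where "tau_MCM R =
    {r \<in> carrier R. \<forall>M :: ('a, 'a list) module. MCM_module R M \<longrightarrow> r \<in> tau R M}"


section \<open>The field and the ring\<close>

definition perfect_field :: "'k::field itself \<Rightarrow> bool"
  where "perfect_field _ \<longleftrightarrow> CHAR('k) = 0 \<or> surj (\<lambda>a::'k. a ^ CHAR('k))"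

text \<open>
  \<open>k\<lbrakk>x, y\<rbrakk>\<close> as \<open>k\<lbrakk>x\<rbrakk>\<lbrakk>y\<rbrakk>\<close>: the coefficient of \<open>x\<^sup>i y\<^sup>j\<close> in \<open>f\<close> is \<open>fps_nth (fps_nth f j) i\<close>, and
  \<open>y\<close> is the outer variable \<open>fps_X\<close>.
\<close>

definition power_series_xy :: "'k::field fps fps ring"
  where "power_series_xy = ring_of_type_algebra"

definition y_var :: "'k::field fps fps"
  where "y_var = fps_X"


section \<open>Independence of the type of module elements\<close>

lemma submodule_span_submodule:
  assumes "module R M" "S \<subseteq> carrier M"
  shows "submodule (submodule_span R M S) R M"
proof -
  interpret module R M by fact
  have c: "carrier M \<in> {N. submodule N R M \<and> S \<subseteq> N}"
    using carrier_is_submodule assms(2) by auto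
  show ?thesis
  proof (rule submoduleI)
    show "submodule_span R M S \<subseteq> carrier M"
      unfolding submodule_span_def using c by blast
    show "\<zero>\<^bsub>M\<^esub> \<in> submodule_span R M S"
      unfolding submodule_span_def
      by (auto simp: submodule_def dest: subgroup.one_closed)
  next
    fix a assume "a \<in> submodule_span R M S"
    then show "\<ominus>\<^bsub>M\<^esub> a \<in> submodule_span R M S"
      unfolding submodule_span_def using submoduleE(3) by auto
  next
    fix a b assume "a \<in> submodule_span R M S" "b \<in> submodule_span R M S"
    then show "a \<oplus>\<^bsub>M\<^esub> b \<in> submodule_span R M S"
      unfolding submodule_span_def using submoduleE(5) by auto
  next
    fix a b assume "a \<in> carrier R" "b \<in> submodule_span R M S"
    then show "a \<odot>\<^bsub>M\<^esub> b \<in> submodule_span R M S"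
      unfolding submodule_span_def using submoduleE(4) by auto
  qed
qed

lemma submodule_span_superset: "S \<subseteq> submodule_span R M S"
  unfolding submodule_span_def by auto

lemma submodule_span_least: "submodule N R M \<Longrightarrow> S \<subseteq> N \<Longrightarrow> submodule_span R M S \<subseteq> N"
  unfolding submodule_span_def by auto

lemma ideal_smult_submodule:
  assumes "module R M" "I \<subseteq> carrier R"
  shows "submodule (ideal_smult R M I) R M"
proof -
  interpret module R M by fact
  show ?thesis
    unfolding ideal_smult_def using assms by (intro submodule_span_submodule) auto
qed

lemma nonzerodivisor_on_quot_module:
  assumes "module R M" "submodule N R M" "x \<in> carrier R"
  shows "nonzerodivisor_on (quot_module M N) x \<longleftrightarrow>
    (\<forall>m\<in>carrier M. x \<odot>\<^bsub>M\<^esub> m \<in> N \<longrightarrow> m \<in> N)"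
proof -
  interpret module R M by fact
  interpret N: submodule N R M by fact
  interpret A: additive_subgroup N M
    by (intro additive_subgroup.intro) (rule N.subgroup_axioms)
  interpret A: abelian_subgroup N M
    by (rule abelian_subgroupI3) (unfold_locales)
  have zero: "N +>\<^bsub>M\<^esub> m = N \<longleftrightarrow> m \<in> N" if "m \<in> carrier M" for m
    using that A.a_rcos_self[OF that] M.a_coset_join2[OF that A.a_subgroup] by auto
  have smult: "(\<Union>n\<in>N +>\<^bsub>M\<^esub> m. N +>\<^bsub>M\<^esub> (x \<odot>\<^bsub>M\<^esub> n)) = N +>\<^bsub>M\<^esub> (x \<odot>\<^bsub>M\<^esub> m)" if m: "m \<in> carrier M" for m
  proof -
    have "N +>\<^bsub>M\<^esub> (x \<odot>\<^bsub>M\<^esub> n) = N +>\<^bsub>M\<^esub> (x \<odot>\<^bsub>M\<^esub> m)" if n: "n \<in> N +>\<^bsub>M\<^esub> m" for n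
    proof -
      obtain h where h: "h \<in> N" "n = h \<oplus>\<^bsub>M\<^esub> m"
        using n unfolding a_r_coset_def' by auto
      have "x \<odot>\<^bsub>M\<^esub> n = x \<odot>\<^bsub>M\<^esub> h \<oplus>\<^bsub>M\<^esub> x \<odot>\<^bsub>M\<^esub> m"
        using h m assms(3) A.a_subset by (auto simp: smult_r_distr)
      moreover have "x \<odot>\<^bsub>M\<^esub> h \<in> N" using h assms(3) by auto
      ultimately have "x \<odot>\<^bsub>M\<^esub> n \<in> N +>\<^bsub>M\<^esub> (x \<odot>\<^bsub>M\<^esub> m)"
        unfolding a_r_coset_def' by auto
      then show ?thesis
        using A.a_repr_independence' assms(3) m by auto
    qed
    moreover have "m \<in> N +>\<^bsub>M\<^esub> m" using A.a_rcos_self m by auto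
    ultimately show ?thesis by blast
  qed
  show ?thesis
    unfolding nonzerodivisor_on_def quot_module_def
    using zero smult assms(3) by (auto simp: A_RCOSETS_def')
qed

lemma mod_homD:
  assumes "f \<in> mod_hom R M N"
  shows "m \<in> carrier M \<Longrightarrow> f m \<in> carrier N"
    and "m \<in> carrier M \<Longrightarrow> n \<in> carrier M \<Longrightarrow> f (m \<oplus>\<^bsub>M\<^esub> n) = f m \<oplus>\<^bsub>N\<^esub> f n"
    and "a \<in> carrier R \<Longrightarrow> m \<in> carrier M \<Longrightarrow> f (a \<odot>\<^bsub>M\<^esub> m) = a \<odot>\<^bsub>N\<^esub> f m"
  using assms unfolding mod_hom_def hom_def by auto

lemma mod_homI:
  assumes "\<And>m. m \<in> carrier M \<Longrightarrow> f m \<in> carrier N"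
    and "\<And>m n. m \<in> carrier M \<Longrightarrow> n \<in> carrier M \<Longrightarrow> f (m \<oplus>\<^bsub>M\<^esub> n) = f m \<oplus>\<^bsub>N\<^esub> f n"
    and "\<And>a m. a \<in> carrier R \<Longrightarrow> m \<in> carrier M \<Longrightarrow> f (a \<odot>\<^bsub>M\<^esub> m) = a \<odot>\<^bsub>N\<^esub> f m"
  shows "f \<in> mod_hom R M N"
  using assms unfolding mod_hom_def hom_def by auto

lemma mod_hom_zero:
  assumes "module R M" "module R N" "f \<in> mod_hom R M N"
  shows "f \<zero>\<^bsub>M\<^esub> = \<zero>\<^bsub>N\<^esub>"
proof -
  interpret M: module R M by fact
  interpret N: module R N by fact
  have "f (\<zero>\<^bsub>R\<^esub> \<odot>\<^bsub>M\<^esub> \<zero>\<^bsub>M\<^esub>) = \<zero>\<^bsub>R\<^esub> \<odot>\<^bsub>N\<^esub> f \<zero>\<^bsub>M\<^esub>"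
    by (intro mod_homD(3)[OF assms(3)]) auto
  then show ?thesis using mod_homD(1)[OF assms(3)] by auto
qed

lemma mod_iso_inv:
  assumes "module R M" "f \<in> mod_iso R M N"
  shows "inv_into (carrier M) f \<in> mod_iso R N M"
proof -
  interpret M: module R M by fact
  have f: "f \<in> mod_hom R M N" and b: "bij_betw f (carrier M) (carrier N)"
    using assms(2) unfolding mod_iso_def by auto
  let ?g = "inv_into (carrier M) f"
  have g: "?g n \<in> carrier M" "f (?g n) = n" if "n \<in> carrier N" for n
    using b that by (auto simp: bij_betw_def inv_into_into f_inv_into_f)
  have gf: "?g (f m) = m" if "m \<in> carrier M" for m
    using b that by (auto simp: bij_betw_def)
  have "?g \<in> mod_hom R N M"
  proof (rule mod_homI)
    fix m n assume *: "m \<in> carrier N" "n \<in> carrier N"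
    have "f (?g m \<oplus>\<^bsub>M\<^esub> ?g n) = m \<oplus>\<^bsub>N\<^esub> n"
      using g * mod_homD(2)[OF f] by auto
    then show "?g (m \<oplus>\<^bsub>N\<^esub> n) = ?g m \<oplus>\<^bsub>M\<^esub> ?g n"
      using gf g * by (metis M.add.m_closed)
  next
    fix a n assume *: "a \<in> carrier R" "n \<in> carrier N"
    have "f (a \<odot>\<^bsub>M\<^esub> ?g n) = a \<odot>\<^bsub>N\<^esub> n"
      using g * mod_homD(3)[OF f] by auto
    then show "?g (a \<odot>\<^bsub>N\<^esub> n) = a \<odot>\<^bsub>M\<^esub> ?g n"
      using gf g * by (metis M.smult_closed)
  qed (use g in auto)
  then show ?thesis
    unfolding mod_iso_def using b bij_betw_inv_into by auto
qed

lemma submodule_image: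
  assumes "module R M" "module R N" "f \<in> mod_hom R M N" "submodule H R M"
  shows "submodule (f ` H) R N"
proof -
  interpret M: module R M by fact
  interpret N: module R N by fact
  note H = M.submoduleE[OF assms(4)]
  note f = mod_homD[OF assms(3)]
  have z: "\<zero>\<^bsub>M\<^esub> \<in> H" using assms(4) by (auto simp: submodule_def dest: subgroup.one_closed)
  show ?thesis
  proof (rule N.submoduleI)
    show "f ` H \<subseteq> carrier N" using H(1) f(1) by auto
    show "\<zero>\<^bsub>N\<^esub> \<in> f ` H" using mod_hom_zero[OF assms(1-3)] z by force
  next
    fix a assume "a \<in> f ` H"
    then obtain m where m: "m \<in> H" "a = f m" by auto
    have mM: "m \<in> carrier M" using m(1) H(1) by blast
    have "f (\<ominus>\<^bsub>M\<^esub> m) \<oplus>\<^bsub>N\<^esub> f m = f (\<ominus>\<^bsub>M\<^esub> m \<oplus>\<^bsub>M\<^esub> m)"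
      by (rule f(2)[symmetric]) (use mM in simp_all)
    also have "\<dots> = \<zero>\<^bsub>N\<^esub>" using mM mod_hom_zero[OF assms(1-3)] by (simp add: M.l_neg)
    finally have "\<ominus>\<^bsub>N\<^esub> a = f (\<ominus>\<^bsub>M\<^esub> m)"
      unfolding m(2) using f(1)[of m] f(1)[of "\<ominus>\<^bsub>M\<^esub> m"] mM by (intro N.minus_equality) simp_all
    then show "\<ominus>\<^bsub>N\<^esub> a \<in> f ` H" using m H(3) by auto
  next
    fix a b assume "a \<in> f ` H" "b \<in> f ` H"
    then obtain m n where m: "m \<in> H" "a = f m" "n \<in> H" "b = f n" by auto
    have "a \<oplus>\<^bsub>N\<^esub> b = f (m \<oplus>\<^bsub>M\<^esub> n)" using m f(2)[of m n] subsetD[OF H(1)] by simp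
    then show "a \<oplus>\<^bsub>N\<^esub> b \<in> f ` H" using m H(5) by auto
  next
    fix a b assume a: "a \<in> carrier R" "b \<in> f ` H"
    then obtain m where m: "m \<in> H" "b = f m" by auto
    have "a \<odot>\<^bsub>N\<^esub> b = f (a \<odot>\<^bsub>M\<^esub> m)" using m a f(3)[of a m] H(1) by auto
    then show "a \<odot>\<^bsub>N\<^esub> b \<in> f ` H" using m a H(4) by auto
  qed
qed

lemma submodule_span_image:
  assumes "module R M" "module R N" "f \<in> mod_iso R M N" "S \<subseteq> carrier M"
  shows "f ` submodule_span R M S = submodule_span R N (f ` S)"
proof -
  have f: "f \<in> mod_hom R M N" and b: "bij_betw f (carrier M) (carrier N)"
    using assms(3) unfolding mod_iso_def by auto
  let ?g = "inv_into (carrier M) f"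
  have g: "?g \<in> mod_hom R N M"
    using mod_iso_inv[OF assms(1,3)] unfolding mod_iso_def by auto
  have fS: "f ` S \<subseteq> carrier N" using assms(4) b by (auto simp: bij_betw_def)
  have sM: "submodule_span R M S \<subseteq> carrier M"
    using submodule_span_submodule[OF assms(1,4)] assms(1) module.submoduleE(1) by blast
  have sN: "submodule_span R N (f ` S) \<subseteq> carrier N"
    using submodule_span_submodule[OF assms(2) fS] assms(2) module.submoduleE(1) by blast
  show ?thesis
  proof
    have "submodule (?g ` submodule_span R N (f ` S)) R M"
      using submodule_image[OF assms(2,1) g] submodule_span_submodule[OF assms(2) fS] by auto
    moreover have "S \<subseteq> ?g ` submodule_span R N (f ` S)"
    proof
      fix s assume s: "s \<in> S"
      have "?g (f s) = s" using b s assms(4) by (auto simp: bij_betw_def)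
      then show "s \<in> ?g ` submodule_span R N (f ` S)"
        using s submodule_span_superset[of "f ` S" R N] by force
    qed
    ultimately have "submodule_span R M S \<subseteq> ?g ` submodule_span R N (f ` S)"
      by (rule submodule_span_least)
    then have "f ` submodule_span R M S \<subseteq> f ` ?g ` submodule_span R N (f ` S)" by blast
    also have "\<dots> = submodule_span R N (f ` S)"
      using b sN by (simp add: bij_betw_def image_inv_into_cancel)
    finally show "f ` submodule_span R M S \<subseteq> submodule_span R N (f ` S)" .
  next
    show "submodule_span R N (f ` S) \<subseteq> f ` submodule_span R M S"
      using submodule_span_superset[of S R M]
      by (intro submodule_span_least submodule_image[OF assms(1,2) f]
            submodule_span_submodule[OF assms(1,4)]) auto
  qed
qed

lemma ideal_smult_image:
  assumes "module R M" "module R N" "f \<in> mod_iso R M N" "I \<subseteq> carrier R"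
  shows "f ` ideal_smult R M I = ideal_smult R N I"
proof -
  interpret M: module R M by fact
  have f: "f \<in> mod_hom R M N" and b: "bij_betw f (carrier M) (carrier N)"
    using assms(3) unfolding mod_iso_def by auto
  let ?S = "\<lambda>M. {a \<odot>\<^bsub>M\<^esub> m | a m. a \<in> I \<and> m \<in> carrier M}"
  have "f ` ?S M = {a \<odot>\<^bsub>N\<^esub> n | a n. a \<in> I \<and> n \<in> f ` carrier M}"
  proof (intro equalityI subsetI)
    fix z assume "z \<in> f ` ?S M"
    then obtain a m where "a \<in> I" "m \<in> carrier M" "z = f (a \<odot>\<^bsub>M\<^esub> m)" by auto
    then show "z \<in> {a \<odot>\<^bsub>N\<^esub> n | a n. a \<in> I \<and> n \<in> f ` carrier M}"
      using mod_homD(3)[OF f] assms(4) by blast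
  next
    fix z assume "z \<in> {a \<odot>\<^bsub>N\<^esub> n | a n. a \<in> I \<and> n \<in> f ` carrier M}"
    then obtain a m where "a \<in> I" "m \<in> carrier M" "z = a \<odot>\<^bsub>N\<^esub> f m" by auto
    then have "z = f (a \<odot>\<^bsub>M\<^esub> m)" "a \<odot>\<^bsub>M\<^esub> m \<in> ?S M"
      using mod_homD(3)[OF f] assms(4) by auto
    then show "z \<in> f ` ?S M" by blast
  qed
  also have "\<dots> = {a \<odot>\<^bsub>N\<^esub> n | a n. a \<in> I \<and> n \<in> carrier N}" using b by (simp add: bij_betw_def)
  finally have eq: "f ` ?S M = {a \<odot>\<^bsub>N\<^esub> n | a n. a \<in> I \<and> n \<in> carrier N}" .
  have "?S M \<subseteq> carrier M" using assms(4) by auto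
  from submodule_span_image[OF assms(1-3) this] show ?thesis
    unfolding ideal_smult_def eq .
qed

lemma regular_sequence_iso_imp:
  assumes M: "module R M" and N: "module R N" and f: "f \<in> mod_iso R M N"
    and xs: "regular_sequence R M xs"
  shows "regular_sequence R N xs"
proof -
  interpret M: module R M by fact
  have hom: "f \<in> mod_hom R M N" and b: "bij_betw f (carrier M) (carrier N)"
    using f unfolding mod_iso_def by auto
  have inj: "inj_on f (carrier M)" and im: "f ` carrier M = carrier N"
    using b by (auto simp: bij_betw_def)
  have sub: "set xs \<subseteq> carrier R" using xs unfolding regular_sequence_def by auto
  have idl: "Idl\<^bsub>R\<^esub> (set (take i xs)) \<subseteq> carrier R" for i
  proof -
    have "set (take i xs) \<subseteq> carrier R" using sub set_take_subset[of i xs] by blast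
    then show ?thesis
      by (intro additive_subgroup.a_subset ideal.axioms(1)) (rule M.R.genideal_ideal)
  qed
  have idl': "Idl\<^bsub>R\<^esub> (set xs) \<subseteq> carrier R" using idl[of "length xs"] by simp
  have "ideal_smult R N (Idl\<^bsub>R\<^esub> (set xs)) \<noteq> carrier N"
  proof
    assume "ideal_smult R N (Idl\<^bsub>R\<^esub> (set xs)) = carrier N"
    then have "f ` ideal_smult R M (Idl\<^bsub>R\<^esub> (set xs)) = f ` carrier M"
      using ideal_smult_image[OF M N f idl'] im by simp
    then have "ideal_smult R M (Idl\<^bsub>R\<^esub> (set xs)) = carrier M"
      using inj_on_image_eq_iff[OF inj] M.submoduleE(1)[OF ideal_smult_submodule[OF M idl']] by blast
    then show False using xs unfolding regular_sequence_def by auto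
  qed
  moreover have "nonzerodivisor_on (quot_module N (ideal_smult R N (Idl\<^bsub>R\<^esub> (set (take i xs))))) (xs ! i)"
    if i: "i < length xs" for i
  proof -
    let ?A = "ideal_smult R M (Idl\<^bsub>R\<^esub> (set (take i xs)))"
    let ?B = "ideal_smult R N (Idl\<^bsub>R\<^esub> (set (take i xs)))"
    have A: "submodule ?A R M" and B: "submodule ?B R N"
      using ideal_smult_submodule[OF M idl] ideal_smult_submodule[OF N idl] by auto
    have AB: "f ` ?A = ?B" by (rule ideal_smult_image[OF M N f idl])
    have mem: "f m \<in> ?B \<longleftrightarrow> m \<in> ?A" if "m \<in> carrier M" for m
      unfolding AB[symmetric] using inj_on_image_mem_iff[OF inj that] M.submoduleE(1)[OF A] by auto
    have x: "xs ! i \<in> carrier R" using sub i by auto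
    have "\<forall>m\<in>carrier M. xs ! i \<odot>\<^bsub>M\<^esub> m \<in> ?A \<longrightarrow> m \<in> ?A"
      using xs i nonzerodivisor_on_quot_module[OF M A x] unfolding regular_sequence_def by auto
    then have "\<forall>m\<in>carrier M. xs ! i \<odot>\<^bsub>N\<^esub> f m \<in> ?B \<longrightarrow> f m \<in> ?B"
      using mem mod_homD(3)[OF hom x] M.smult_closed[OF x] by metis
    then have "\<forall>n\<in>f ` carrier M. xs ! i \<odot>\<^bsub>N\<^esub> n \<in> ?B \<longrightarrow> n \<in> ?B" by auto
    then show ?thesis unfolding im nonzerodivisor_on_quot_module[OF N B x] .
  qed
  ultimately show ?thesis using sub unfolding regular_sequence_def by auto
qed

lemma MCM_module_iso:
  assumes "MCM_module R M" "module R N" "f \<in> mod_iso R M N"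
  shows "MCM_module R N"
proof -
  have M: "module R M" using assms(1) unfolding MCM_module_def by auto
  have g: "inv_into (carrier M) f \<in> mod_iso R N M" by (rule mod_iso_inv[OF M assms(3)])
  have f: "f \<in> mod_hom R M N" and b: "f ` carrier M = carrier N" "inj_on f (carrier M)"
    using assms(3) unfolding mod_iso_def bij_betw_def by auto
  have "regular_sequence R M = regular_sequence R N"
    using regular_sequence_iso_imp[OF M assms(2,3)] regular_sequence_iso_imp[OF assms(2) M g]
    by blast
  then have "module_depth R N = module_depth R M" unfolding module_depth_def by simp
  moreover have "fin_gen_module R N"
  proof -
    obtain S where S: "finite S" "S \<subseteq> carrier M" "submodule_span R M S = carrier M"
      using assms(1) unfolding MCM_module_def fin_gen_module_def by auto
    have "submodule_span R N (f ` S) = carrier N"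
      using submodule_span_image[OF M assms(2,3) S(2)] S(3) b by simp
    moreover have "f ` S \<subseteq> carrier N" using S(2) b(1) by blast
    ultimately show ?thesis unfolding fin_gen_module_def using S(1) by blast
  qed
  moreover have "carrier N \<noteq> {\<zero>\<^bsub>N\<^esub>}"
  proof
    assume "carrier N = {\<zero>\<^bsub>N\<^esub>}"
    then have "f ` carrier M = f ` {\<zero>\<^bsub>M\<^esub>}" using b mod_hom_zero[OF M assms(2) f] by simp
    moreover have "\<zero>\<^bsub>M\<^esub> \<in> carrier M"
      using M by (simp add: module_def abelian_group_def abelian_monoid.zero_closed)
    ultimately have "carrier M = {\<zero>\<^bsub>M\<^esub>}" using inj_on_image_eq_iff[OF b(2)] by blast
    then show False using assms(1) unfolding MCM_module_def by auto
  qed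
  ultimately show ?thesis using assms unfolding MCM_module_def by auto
qed

lemma tau_iso_subset:
  assumes f: "f \<in> mod_iso R M N"
  shows "tau R N \<subseteq> tau R M"
proof -
  have hom: "f \<in> mod_hom R M N" and im: "f ` carrier M = carrier N"
    using f unfolding mod_iso_def bij_betw_def by auto
  have "g ` carrier N \<subseteq> (\<Union>h\<in>mod_hom R M (self_module R). h ` carrier M)"
    if g: "g \<in> mod_hom R N (self_module R)" for g
  proof -
    have "g \<circ> f \<in> mod_hom R M (self_module R)"
      using mod_homD[OF hom] mod_homD[OF g] by (intro mod_homI) auto
    moreover have "g ` carrier N = (g \<circ> f) ` carrier M" by (simp only: image_comp[symmetric] im)
    ultimately show ?thesis by blast
  qed
  then show ?thesis unfolding tau_def genideal_def by blast
qed

lemma module_transport: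
  assumes M: "module R M" and inj: "inj_on h (carrier M)"
  obtains N :: "('a, 'e) module" where "module R N" "h \<in> mod_iso R M N"
proof -
  interpret M: module R M by fact
  let ?g = "inv_into (carrier M) h"
  define N :: "('a, 'e) module" where "N =
    \<lparr>carrier = h ` carrier M, monoid.mult = undefined, one = undefined, ring.zero = h \<zero>\<^bsub>M\<^esub>,
     add = (\<lambda>x y. h (?g x \<oplus>\<^bsub>M\<^esub> ?g y)), module.smult = (\<lambda>a x. h (a \<odot>\<^bsub>M\<^esub> ?g x))\<rparr>"
  have gh: "?g (h m) = m" if "m \<in> carrier M" for m using inj that by auto
  have "abelian_group N"
  proof (rule abelian_groupI)
    fix x assume "x \<in> carrier N"
    then obtain m where m: "m \<in> carrier M" "x = h m" by (auto simp: N_def)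
    then show "\<exists>y\<in>carrier N. y \<oplus>\<^bsub>N\<^esub> x = \<zero>\<^bsub>N\<^esub>"
      by (intro bexI[of _ "h (\<ominus>\<^bsub>M\<^esub> m)"]) (auto simp: N_def gh M.l_neg)
  next
    fix x y z assume "x \<in> carrier N" "y \<in> carrier N" "z \<in> carrier N"
    then show "(x \<oplus>\<^bsub>N\<^esub> y) \<oplus>\<^bsub>N\<^esub> z = x \<oplus>\<^bsub>N\<^esub> (y \<oplus>\<^bsub>N\<^esub> z)"
      by (auto simp: N_def gh M.a_assoc)
  next
    fix x y assume "x \<in> carrier N" "y \<in> carrier N"
    then show "x \<oplus>\<^bsub>N\<^esub> y = y \<oplus>\<^bsub>N\<^esub> x"
      by (auto simp: N_def gh M.a_comm)
  qed (auto simp: N_def gh)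
  then have N: "module R N"
    by (intro moduleI M.R.is_cring)
       (auto simp: N_def gh M.smult_l_distr M.smult_r_distr M.smult_assoc1)
  have "h \<in> mod_hom R M N"
    by (rule mod_homI) (auto simp: N_def gh)
  then have "h \<in> mod_iso R M N" using inj by (auto simp: mod_iso_def bij_betw_def N_def)
  with N show thesis by (rule that)
qed

primrec lin_comb :: "('a, 'b, 'd) module_scheme \<Rightarrow> 'b list \<Rightarrow> 'a list \<Rightarrow> 'b" where
  "lin_comb M [] cs = \<zero>\<^bsub>M\<^esub>"
| "lin_comb M (m # ms) cs = hd cs \<odot>\<^bsub>M\<^esub> m \<oplus>\<^bsub>M\<^esub> lin_comb M ms (tl cs)"

lemma lin_comb_range_submodule:
  assumes M: "module R M"
  shows "set ms \<subseteq> carrier M \<Longrightarrow>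
    submodule (lin_comb M ms ` {cs. length cs = length ms \<and> set cs \<subseteq> carrier R}) R M \<and>
    set ms \<subseteq> lin_comb M ms ` {cs. length cs = length ms \<and> set cs \<subseteq> carrier R}"
proof (induction ms)
  case Nil
  interpret M: module R M by fact
  have "lin_comb M [] ` {cs. length cs = length [] \<and> set cs \<subseteq> carrier R} = {\<zero>\<^bsub>M\<^esub>}" by auto
  moreover have "submodule {\<zero>\<^bsub>M\<^esub>} R M" by (rule M.submoduleI) auto
  ultimately show ?case by simp
next
  case (Cons m ms)
  interpret M: module R M by fact
  let ?H = "lin_comb M ms ` {cs. length cs = length ms \<and> set cs \<subseteq> carrier R}"
  let ?K = "lin_comb M (m # ms) ` {cs. length cs = length (m # ms) \<and> set cs \<subseteq> carrier R}"
  have m: "m \<in> carrier M" and sub: "submodule ?H R M" and ms: "set ms \<subseteq> ?H"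
    using Cons by auto
  have HM: "?H \<subseteq> carrier M" by (rule M.submoduleE(1)[OF sub])
  have z: "\<zero>\<^bsub>M\<^esub> \<in> ?H" using sub by (auto simp: submodule_def dest: subgroup.one_closed)
  have K: "?K = {a \<odot>\<^bsub>M\<^esub> m \<oplus>\<^bsub>M\<^esub> n | a n. a \<in> carrier R \<and> n \<in> ?H}" (is "_ = ?L")
  proof (intro equalityI subsetI)
    fix v assume "v \<in> ?K"
    then obtain c where c: "length c = Suc (length ms)" "set c \<subseteq> carrier R"
      "v = lin_comb M (m # ms) c" by auto
    then obtain a cs where "c = a # cs" by (cases c) auto
    then show "v \<in> ?L" using c by auto
  next
    fix v assume "v \<in> ?L"
    then obtain a cs where "a \<in> carrier R" "length cs = length ms" "set cs \<subseteq> carrier R"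
      "v = a \<odot>\<^bsub>M\<^esub> m \<oplus>\<^bsub>M\<^esub> lin_comb M ms cs" by auto
    then show "v \<in> ?K" by (intro image_eqI[of _ _ "a # cs"]) auto
  qed
  have KI: "a \<odot>\<^bsub>M\<^esub> m \<oplus>\<^bsub>M\<^esub> n \<in> ?L" if "a \<in> carrier R" "n \<in> ?H" for a n using that by blast
  have "submodule ?L R M"
  proof (rule M.submoduleI)
    show "?L \<subseteq> carrier M" using m HM by auto
    show "\<zero>\<^bsub>M\<^esub> \<in> ?L" using KI[OF M.R.zero_closed z] m by simp
  next
    fix v assume "v \<in> ?L"
    then obtain a n where v: "a \<in> carrier R" "n \<in> ?H" "v = a \<odot>\<^bsub>M\<^esub> m \<oplus>\<^bsub>M\<^esub> n" by blast
    have n: "n \<in> carrier M" using v(2) HM by blast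
    have "\<ominus>\<^bsub>M\<^esub> v = (\<ominus>\<^bsub>R\<^esub> a) \<odot>\<^bsub>M\<^esub> m \<oplus>\<^bsub>M\<^esub> \<ominus>\<^bsub>M\<^esub> n"
      using v n m by (simp add: M.smult_l_minus M.minus_add)
    then show "\<ominus>\<^bsub>M\<^esub> v \<in> ?L"
      using KI[of "\<ominus>\<^bsub>R\<^esub> a" "\<ominus>\<^bsub>M\<^esub> n"] v(1) M.submoduleE(3)[OF sub v(2)] by simp
  next
    fix v w assume "v \<in> ?L" "w \<in> ?L"
    then obtain a n b l where v: "a \<in> carrier R" "n \<in> ?H" "v = a \<odot>\<^bsub>M\<^esub> m \<oplus>\<^bsub>M\<^esub> n"
      and w: "b \<in> carrier R" "l \<in> ?H" "w = b \<odot>\<^bsub>M\<^esub> m \<oplus>\<^bsub>M\<^esub> l" by blast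
    have n: "n \<in> carrier M" "l \<in> carrier M" using v(2) w(2) HM by blast+
    have "v \<oplus>\<^bsub>M\<^esub> w = (a \<oplus>\<^bsub>R\<^esub> b) \<odot>\<^bsub>M\<^esub> m \<oplus>\<^bsub>M\<^esub> (n \<oplus>\<^bsub>M\<^esub> l)"
      using v(1,3) w(1,3) n m by (simp add: M.smult_l_distr M.a_ac)
    then show "v \<oplus>\<^bsub>M\<^esub> w \<in> ?L"
      using KI[of "a \<oplus>\<^bsub>R\<^esub> b" "n \<oplus>\<^bsub>M\<^esub> l"] v(1) w(1) M.submoduleE(5)[OF sub v(2) w(2)] by simp
  next
    fix b v assume b: "b \<in> carrier R" and "v \<in> ?L"
    then obtain a n where v: "a \<in> carrier R" "n \<in> ?H" "v = a \<odot>\<^bsub>M\<^esub> m \<oplus>\<^bsub>M\<^esub> n" by blast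
    have n: "n \<in> carrier M" using v(2) HM by blast
    have "b \<odot>\<^bsub>M\<^esub> v = (b \<otimes>\<^bsub>R\<^esub> a) \<odot>\<^bsub>M\<^esub> m \<oplus>\<^bsub>M\<^esub> b \<odot>\<^bsub>M\<^esub> n"
      using v(1,3) b n m by (simp add: M.smult_r_distr M.smult_assoc1)
    then show "b \<odot>\<^bsub>M\<^esub> v \<in> ?L"
      using KI[of "b \<otimes>\<^bsub>R\<^esub> a" "b \<odot>\<^bsub>M\<^esub> n"] v(1) b M.submoduleE(4)[OF sub b v(2)] by simp
  qed
  moreover have "m \<in> ?L" using KI[OF M.R.one_closed z] m by simp
  moreover have "set ms \<subseteq> ?L"
  proof
    fix n assume "n \<in> set ms"
    then have "n \<in> ?H" using ms by auto
    moreover have "n \<in> carrier M" using calculation HM by blast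
    ultimately show "n \<in> ?L" using KI[OF M.R.zero_closed, of n] m by simp
  qed
  ultimately show ?case unfolding K by simp
qed

lemma fin_gen_module_copy:
  fixes R :: "('a, 'c) ring_scheme" and M :: "('a, 'b, 'd) module_scheme"
  assumes M: "module R M" and fg: "fin_gen_module R M"
  obtains N :: "('a, 'a list) module" and h where "module R N" "h \<in> mod_iso R M N"
proof -
  obtain S where S: "finite S" "S \<subseteq> carrier M" "submodule_span R M S = carrier M"
    using fg unfolding fin_gen_module_def by auto
  obtain ms where ms: "set ms = S" using finite_list[OF S(1)] by auto
  let ?C = "{cs. length cs = length ms \<and> set cs \<subseteq> carrier R}"
  have "carrier M \<subseteq> lin_comb M ms ` ?C"
    using lin_comb_range_submodule[OF M, of ms] ms S submodule_span_least by metis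
  then have "inj_on (inv_into ?C (lin_comb M ms)) (carrier M)"
    using inj_on_inv_into by blast
  then show thesis using module_transport[OF M] that by blast
qed

lemma tau_MCM_subset_tau:
  assumes "MCM_module R M"
  shows "tau_MCM R \<subseteq> tau R M"
proof -
  have M: "module R M" "fin_gen_module R M" using assms unfolding MCM_module_def by auto
  obtain N :: "('a, 'a list) module" and h where N: "module R N" "h \<in> mod_iso R M N"
    using fin_gen_module_copy[OF M] by blast
  have "MCM_module R N" by (rule MCM_module_iso[OF assms N])
  then have "tau_MCM R \<subseteq> tau R N" unfolding tau_MCM_def by auto
  then show ?thesis using tau_iso_subset[OF N(2)] by blast
qed

end

theory Submission
  imports Defs
begin

text \<open>
  Write \<open>R\<close> as the set of all \<open>a + b y\<close> with \<open>a, b \<in> k\<lbrakk>x\<rbrakk>\<close> and \<open>y\<^sup>2 = 0\<close>.  Its prime ideals are \<open>(y)\<close> and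
  \<open>(x, y)\<close>, so it has dimension \<open>1\<close> (\<open>krull_dim_eq_1\<close>).

  A single module gives the upper bound: \<open>R/(y)\<close> is maximal Cohen-Macaulay
  (\<open>MCM_mod_y\<close>), and a homomorphism from it to \<open>R\<close> has its values in the annihilator of \<open>y\<close>, which is
  \<open>(y)\<close> itself (\<open>tau_mod_y\<close>).

  Conversely, let \<open>M\<close> be any maximal Cohen-Macaulay module.  Some \<open>a + b y\<close> in the maximal ideal is a
  nonzerodivisor on \<open>M\<close>; as \<open>y\<close> is nilpotent, \<open>x\<close> is a nonzerodivisor as well.  Hence \<open>M\<close> is
  finitely generated and torsion-free over the discrete valuation ring \<open>k\<lbrakk>x\<rbrakk>\<close> (\<open>MCM_torsion_free\<close>) and therefore free.
  Multiplication by \<open>y\<close> is a nilpotent \<open>k\<lbrakk>x\<rbrakk>\<close>-linear map on \<open>M\<close>.  Its kernel is nonzero, and it is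
  closed under division by \<open>x\<close>, so that it contains an element \<open>n\<close> that is part of a basis: there is
  a \<open>k\<lbrakk>x\<rbrakk>\<close>-linear \<open>\<phi> : M \<rightarrow> k\<lbrakk>x\<rbrakk>\<close> with \<open>\<phi> n = 1\<close> (\<open>split_off_fps_X_power\<close>).  The map
  \<open>m \<mapsto> \<phi> (y m) + \<phi> m y\<close> is \<open>R\<close>-linear (\<open>functional_induces_mod_hom\<close>) and sends \<open>n\<close> to \<open>y\<close>, so \<open>y\<close> lies
  in the trace ideal of \<open>M\<close> (\<open>MCM_y_in_tau\<close>).
\<close>

section \<open>Linear combinations in a module\<close>

lemma (in module) finsum_in_submodule:
  assumes N: "submodule N R M" and f: "\<And>s. s \<in> A \<Longrightarrow> f s \<in> N"
  shows "(\<Oplus>\<^bsub>M\<^esub>s\<in>A. f s) \<in> N"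
proof -
  have z: "\<zero>\<^bsub>M\<^esub> \<in> N" using N by (auto simp: submodule_def dest: subgroup.one_closed)
  note NE = submoduleE[OF N]
  show ?thesis
  proof (cases "finite A")
    case True
    then show ?thesis using f
    proof (induction A rule: finite_induct)
      case (insert s A)
      have "(\<Oplus>\<^bsub>M\<^esub>u\<in>insert s A. f u) = f s \<oplus>\<^bsub>M\<^esub> (\<Oplus>\<^bsub>M\<^esub>u\<in>A. f u)"
        using insert NE(1) by (intro M.finsum_insert) auto
      then show ?case using insert NE(5) by auto
    qed (simp add: z)
  qed (simp add: z M.finsum_infinite)
qed

lemma (in module) submodule_span_eq_finsum:
  assumes fin: "finite A" and A: "A \<subseteq> carrier M"
  shows "submodule_span R M A = {(\<Oplus>\<^bsub>M\<^esub>s\<in>A. c s \<odot>\<^bsub>M\<^esub> s) | c. c \<in> A \<rightarrow> carrier R}"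
    (is "_ = ?L")
proof
  have cl: "c s \<odot>\<^bsub>M\<^esub> s \<in> carrier M" if "c \<in> A \<rightarrow> carrier R" "s \<in> A" for c s
    using that A by auto
  have "submodule ?L R M"
  proof (rule submoduleI)
    show "?L \<subseteq> carrier M" using cl by (auto intro!: M.finsum_closed)
    have "(\<Oplus>\<^bsub>M\<^esub>s\<in>A. \<zero> \<odot>\<^bsub>M\<^esub> s) = (\<Oplus>\<^bsub>M\<^esub>s\<in>A. \<zero>\<^bsub>M\<^esub>)"
      using A by (intro M.finsum_cong') auto
    then show "\<zero>\<^bsub>M\<^esub> \<in> ?L"
      by (intro CollectI exI[of _ "\<lambda>_. \<zero>"]) auto
  next
    fix a v assume a: "a \<in> carrier R" and "v \<in> ?L"
    then obtain c where c: "c \<in> A \<rightarrow> carrier R" "v = (\<Oplus>\<^bsub>M\<^esub>s\<in>A. c s \<odot>\<^bsub>M\<^esub> s)" by blast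
    have "a \<odot>\<^bsub>M\<^esub> v = (\<Oplus>\<^bsub>M\<^esub>s\<in>A. a \<odot>\<^bsub>M\<^esub> (c s \<odot>\<^bsub>M\<^esub> s))"
      unfolding c(2) using fin a cl[OF c(1)] by (intro finsum_smult_ldistr) auto
    also have "\<dots> = (\<Oplus>\<^bsub>M\<^esub>s\<in>A. (a \<otimes> c s) \<odot>\<^bsub>M\<^esub> s)"
      using c a A by (intro M.finsum_cong') (auto simp: smult_assoc1 Pi_iff subset_iff)
    finally show "a \<odot>\<^bsub>M\<^esub> v \<in> ?L"
      using a c(1) by (intro CollectI exI[of _ "\<lambda>s. a \<otimes> c s"]) auto
  next
    fix v w assume "v \<in> ?L" "w \<in> ?L"
    then obtain c d where c: "c \<in> A \<rightarrow> carrier R" "v = (\<Oplus>\<^bsub>M\<^esub>s\<in>A. c s \<odot>\<^bsub>M\<^esub> s)"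
      and d: "d \<in> A \<rightarrow> carrier R" "w = (\<Oplus>\<^bsub>M\<^esub>s\<in>A. d s \<odot>\<^bsub>M\<^esub> s)" by blast
    have "v \<oplus>\<^bsub>M\<^esub> w = (\<Oplus>\<^bsub>M\<^esub>s\<in>A. c s \<odot>\<^bsub>M\<^esub> s \<oplus>\<^bsub>M\<^esub> d s \<odot>\<^bsub>M\<^esub> s)"
      unfolding c(2) d(2) using cl c(1) d(1) by (intro M.finsum_addf[symmetric]) auto
    also have "\<dots> = (\<Oplus>\<^bsub>M\<^esub>s\<in>A. (c s \<oplus> d s) \<odot>\<^bsub>M\<^esub> s)"
      using c d A by (intro M.finsum_cong') (auto simp: smult_l_distr Pi_iff subset_iff)
    finally show "v \<oplus>\<^bsub>M\<^esub> w \<in> ?L"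
      using c(1) d(1) by (intro CollectI exI[of _ "\<lambda>s. c s \<oplus> d s"]) auto
  next
    fix v assume "v \<in> ?L"
    then obtain c where c: "c \<in> A \<rightarrow> carrier R" "v = (\<Oplus>\<^bsub>M\<^esub>s\<in>A. c s \<odot>\<^bsub>M\<^esub> s)" by blast
    have v: "v \<in> carrier M" unfolding c(2) using cl[OF c(1)] by (intro M.finsum_closed) auto
    have "\<ominus>\<^bsub>M\<^esub> v = (\<ominus> \<one>) \<odot>\<^bsub>M\<^esub> v" using v by (simp add: smult_l_minus)
    also have "\<dots> = (\<Oplus>\<^bsub>M\<^esub>s\<in>A. (\<ominus> \<one>) \<odot>\<^bsub>M\<^esub> (c s \<odot>\<^bsub>M\<^esub> s))"
      unfolding c(2) using fin cl[OF c(1)] by (intro finsum_smult_ldistr) auto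
    also have "\<dots> = (\<Oplus>\<^bsub>M\<^esub>s\<in>A. (\<ominus> \<one> \<otimes> c s) \<odot>\<^bsub>M\<^esub> s)"
      using c A by (intro M.finsum_cong') (auto simp: smult_assoc1 Pi_iff subset_iff)
    finally show "\<ominus>\<^bsub>M\<^esub> v \<in> ?L"
      using c(1) by (intro CollectI exI[of _ "\<lambda>s. \<ominus> \<one> \<otimes> c s"]) auto
  qed
  moreover have "A \<subseteq> ?L"
  proof
    fix t assume t: "t \<in> A"
    have "(\<Oplus>\<^bsub>M\<^esub>s\<in>A. (if s = t then \<one> else \<zero>) \<odot>\<^bsub>M\<^esub> s) = (\<Oplus>\<^bsub>M\<^esub>s\<in>A. if t = s then s else \<zero>\<^bsub>M\<^esub>)"
      using A by (intro M.finsum_cong') auto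
    also have "\<dots> = t" using t fin A by (intro M.finsum_singleton) auto
    finally show "t \<in> ?L" by (intro CollectI exI[of _ "\<lambda>s. if s = t then \<one> else \<zero>"]) auto
  qed
  ultimately show "submodule_span R M A \<subseteq> ?L" by (rule submodule_span_least)
next
  have sub: "submodule (submodule_span R M A) R M"
    by (rule submodule_span_submodule[OF module_axioms A])
  show "?L \<subseteq> submodule_span R M A"
  proof
    fix v assume "v \<in> ?L"
    then obtain c where c: "c \<in> A \<rightarrow> carrier R" "v = (\<Oplus>\<^bsub>M\<^esub>s\<in>A. c s \<odot>\<^bsub>M\<^esub> s)" by blast
    have "c s \<odot>\<^bsub>M\<^esub> s \<in> submodule_span R M A" if "s \<in> A" for s
      using submoduleE(4)[OF sub, of "c s" s] submodule_span_superset[of A R M] c(1) that by auto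
    then show "v \<in> submodule_span R M A" unfolding c(2) by (rule finsum_in_submodule[OF sub])
  qed
qed

section \<open>Finitely generated torsion-free modules over \<open>k\<lbrakk>x\<rbrakk>\<close>\<close>

abbreviation fps_ring :: "'k::field fps ring"
  where "fps_ring \<equiv> ring_of_type_algebra"

lemma fps_ring_simps [simp]:
  "carrier (fps_ring :: 'k::field fps ring) = UNIV"
  "a \<otimes>\<^bsub>fps_ring\<^esub> b = a * b" "a \<oplus>\<^bsub>fps_ring\<^esub> b = a + b"
  "\<one>\<^bsub>fps_ring\<^esub> = 1" "\<zero>\<^bsub>fps_ring\<^esub> = 0" for a b :: "'k::field fps"
  by (simp_all add: ring_of_type_algebra_def)

lemma fps_X_times_fps_shift_1:
  fixes c :: "'k::field fps"
  assumes "fps_nth c 0 = 0"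
  shows "fps_X * fps_shift 1 c = c"
  using assms by (intro fps_ext) (auto simp: fps_X_mult_nth)

text \<open>
  Since \<open>k\<lbrakk>x\<rbrakk>\<close> is a discrete valuation ring, a nonzero coefficient vector is a power of \<open>x\<close> times
  a vector that has a unit among its entries: the power is the least order of an entry.
\<close>

lemma fps_vector_content:
  fixes c :: "'b \<Rightarrow> 'k::field fps"
  assumes "t0 \<in> A" "c t0 \<noteq> 0"
  obtains k d t where "t \<in> A" "fps_nth (d t) 0 \<noteq> 0" "\<forall>s\<in>A. c s = fps_X ^ k * d s"
proof -
  define P where "P s \<longleftrightarrow> s \<in> A \<and> c s \<noteq> 0" for s
  define t where "t = (ARG_MIN (\<lambda>s. subdegree (c s)) s. P s)"
  have P: "P t0" using assms by (auto simp: P_def)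
  have t: "P t" and min: "\<And>s. P s \<Longrightarrow> subdegree (c t) \<le> subdegree (c s)"
    unfolding t_def using arg_min_nat_lemma[of P t0 "\<lambda>s. subdegree (c s)"] P by auto
  let ?k = "subdegree (c t)"
  show thesis
  proof (rule that[of t "\<lambda>s. fps_shift ?k (c s)" ?k]; (intro ballI)?)
    fix s assume "s \<in> A"
    then show "c s = fps_X ^ ?k * fps_shift ?k (c s)"
      using min[of s] fps_shift_times_fps_X_power[of ?k "c s"]
      by (cases "c s = 0") (auto simp: P_def mult.commute)
  qed (use t in \<open>auto simp: P_def\<close>)
qed

locale torsion_free_fps_module =
  module fps_ring M for M :: "('k::field fps, 'b, 'd) module_scheme" (structure) +
  assumes torsion_free: "m \<in> carrier M \<Longrightarrow> fps_X \<odot>\<^bsub>M\<^esub> m = \<zero>\<^bsub>M\<^esub> \<Longrightarrow> m = \<zero>\<^bsub>M\<^esub>"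
begin

lemma smult_fps_X_power_eq_zero:
  "m \<in> carrier M \<Longrightarrow> (fps_X ^ k) \<odot>\<^bsub>M\<^esub> m = \<zero>\<^bsub>M\<^esub> \<Longrightarrow> m = \<zero>\<^bsub>M\<^esub>"
proof (induction k)
  case 0
  then show ?case using smult_one[of m] by simp
next
  case (Suc k)
  then have "fps_X \<odot>\<^bsub>M\<^esub> ((fps_X ^ k) \<odot>\<^bsub>M\<^esub> m) = \<zero>\<^bsub>M\<^esub>"
    using smult_assoc1[of fps_X "fps_X ^ k" m] by simp
  moreover have "(fps_X ^ k) \<odot>\<^bsub>M\<^esub> m \<in> carrier M" using Suc.prems(1) by simp
  ultimately have "(fps_X ^ k) \<odot>\<^bsub>M\<^esub> m = \<zero>\<^bsub>M\<^esub>" by (rule torsion_free[rotated])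
  then show ?case using Suc.IH Suc.prems(1) by blast
qed

lemma finsum_smult_fps_X_power:
  assumes "finite A" "A \<subseteq> carrier M" "\<And>s. s \<in> A \<Longrightarrow> c s = fps_X ^ k * d s"
  shows "(\<Oplus>\<^bsub>M\<^esub>s\<in>A. c s \<odot>\<^bsub>M\<^esub> s) = (fps_X ^ k) \<odot>\<^bsub>M\<^esub> (\<Oplus>\<^bsub>M\<^esub>s\<in>A. d s \<odot>\<^bsub>M\<^esub> s)"
proof -
  have "(fps_X ^ k) \<odot>\<^bsub>M\<^esub> (\<Oplus>\<^bsub>M\<^esub>s\<in>A. d s \<odot>\<^bsub>M\<^esub> s) = (\<Oplus>\<^bsub>M\<^esub>s\<in>A. (fps_X ^ k) \<odot>\<^bsub>M\<^esub> (d s \<odot>\<^bsub>M\<^esub> s))"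
    using assms(1,2) by (intro finsum_smult_ldistr) auto
  also have "\<dots> = (\<Oplus>\<^bsub>M\<^esub>s\<in>A. c s \<odot>\<^bsub>M\<^esub> s)"
  proof (rule M.finsum_cong')
    fix s assume s: "s \<in> A"
    then show "(fps_X ^ k) \<odot>\<^bsub>M\<^esub> (d s \<odot>\<^bsub>M\<^esub> s) = c s \<odot>\<^bsub>M\<^esub> s"
      using smult_assoc1[of "fps_X ^ k" "d s" s] assms(2) assms(3)[OF s] by auto
  qed (use assms(2) in auto)
  finally show ?thesis by simp
qed

definition basis :: "'b set \<Rightarrow> bool"
  where "basis B \<longleftrightarrow> finite B \<and> B \<subseteq> carrier M \<and>
    (\<forall>m\<in>carrier M. \<exists>c. m = (\<Oplus>\<^bsub>M\<^esub>b\<in>B. c b \<odot>\<^bsub>M\<^esub> b)) \<and>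
    (\<forall>c. (\<Oplus>\<^bsub>M\<^esub>b\<in>B. c b \<odot>\<^bsub>M\<^esub> b) = \<zero>\<^bsub>M\<^esub> \<longrightarrow> (\<forall>b\<in>B. c b = 0))"

text \<open>
  A generating set of least cardinality is a basis.  By torsion-freeness a nontrivial relation may
  be divided by a power of \<open>x\<close> until one of its coefficients is a unit, and then the
  corresponding generator is a combination of the others.
\<close>

lemma basis_exists:
  assumes fg: "fin_gen_module fps_ring M"
  shows "\<exists>B. basis B"
proof -
  define P where
    "P B \<longleftrightarrow> finite B \<and> B \<subseteq> carrier M \<and> submodule_span fps_ring M B = carrier M" for B
  obtain B0 where B0: "P B0" using fg unfolding fin_gen_module_def P_def by auto
  define B where "B = (ARG_MIN card B. P B)"
  have B: "P B" and min: "\<And>C. P C \<Longrightarrow> card B \<le> card C"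
    unfolding B_def using arg_min_nat_lemma[of P B0 card] B0 by auto
  have fin: "finite B" and BM: "B \<subseteq> carrier M" and span: "submodule_span fps_ring M B = carrier M"
    using B unfolding P_def by auto
  have "basis B" unfolding basis_def
  proof (intro conjI ballI allI impI)
    fix m assume "m \<in> carrier M"
    then show "\<exists>c. m = (\<Oplus>\<^bsub>M\<^esub>b\<in>B. c b \<odot>\<^bsub>M\<^esub> b)"
      using submodule_span_eq_finsum[OF fin BM] span by auto
  next
    fix c b assume rel: "(\<Oplus>\<^bsub>M\<^esub>b\<in>B. c b \<odot>\<^bsub>M\<^esub> b) = \<zero>\<^bsub>M\<^esub>" and b: "b \<in> B"
    show "c b = 0"
    proof (rule ccontr)
      assume "c b \<noteq> 0"
      then obtain k d t where t: "t \<in> B" "fps_nth (d t) 0 \<noteq> 0"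
        and d: "\<forall>s\<in>B. c s = fps_X ^ k * d s"
        by (rule fps_vector_content[where c = c, OF b])
      have cl: "d s \<odot>\<^bsub>M\<^esub> s \<in> carrier M" if "s \<in> B" for s using that BM by auto
      let ?C = "B - {t}"
      let ?N = "submodule_span fps_ring M ?C"
      have CM: "?C \<subseteq> carrier M" using BM by auto
      have sub: "submodule ?N fps_ring M"
        by (rule submodule_span_submodule[OF module_axioms CM])
      note NE = submoduleE[OF sub]
      have tM: "t \<in> carrier M" using t BM by auto
      define r where "r = (\<Oplus>\<^bsub>M\<^esub>s\<in>?C. d s \<odot>\<^bsub>M\<^esub> s)"
      have rN: "r \<in> ?N"
        unfolding r_def using NE(4) submodule_span_superset[of ?C fps_ring M]
        by (intro finsum_in_submodule[OF sub]) auto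
      have rM: "r \<in> carrier M" using rN NE(1) by auto
      have "(fps_X ^ k) \<odot>\<^bsub>M\<^esub> (\<Oplus>\<^bsub>M\<^esub>s\<in>B. d s \<odot>\<^bsub>M\<^esub> s) = \<zero>\<^bsub>M\<^esub>"
        using rel finsum_smult_fps_X_power[OF fin BM bspec[OF d]] by simp
      then have "(\<Oplus>\<^bsub>M\<^esub>s\<in>B. d s \<odot>\<^bsub>M\<^esub> s) = \<zero>\<^bsub>M\<^esub>"
        by (rule smult_fps_X_power_eq_zero[rotated]) (use cl in \<open>auto intro!: M.finsum_closed\<close>)
      moreover have "(\<Oplus>\<^bsub>M\<^esub>s\<in>insert t ?C. d s \<odot>\<^bsub>M\<^esub> s) = d t \<odot>\<^bsub>M\<^esub> t \<oplus>\<^bsub>M\<^esub> r"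
        unfolding r_def using fin cl t by (intro M.finsum_insert) auto
      ultimately have "d t \<odot>\<^bsub>M\<^esub> t \<oplus>\<^bsub>M\<^esub> r = \<zero>\<^bsub>M\<^esub>" using insert_Diff[OF t(1)] by simp
      then have "d t \<odot>\<^bsub>M\<^esub> t = \<ominus>\<^bsub>M\<^esub> r"
        using cl[OF t(1)] rM M.minus_equality by metis
      then have "d t \<odot>\<^bsub>M\<^esub> t \<in> ?N" using NE(3)[OF rN] by simp
      then have "inverse (d t) \<odot>\<^bsub>M\<^esub> (d t \<odot>\<^bsub>M\<^esub> t) \<in> ?N" using NE(4) by simp
      moreover have "inverse (d t) \<odot>\<^bsub>M\<^esub> (d t \<odot>\<^bsub>M\<^esub> t) = t"
        using smult_assoc1[of "inverse (d t)" "d t" t] smult_one[OF tM] tM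
          inverse_mult_eq_1[OF t(2)] by simp
      ultimately have "t \<in> ?N" by simp
      then have "B \<subseteq> ?N" using submodule_span_superset[of ?C fps_ring M] by auto
      then have "submodule_span fps_ring M B \<subseteq> ?N" by (rule submodule_span_least[OF sub])
      then have "P ?C" using fin CM NE(1) span unfolding P_def by auto
      from min[OF this] show False using card_Diff1_less[OF fin t(1)] by simp
    qed
  qed (rule fin BM)+
  then show ?thesis by blast
qed

text \<open>
  Every nonzero \<open>n\<close> is a power of \<open>x\<close> times an element on which some functional takes the value
  \<open>1\<close>: divide the coordinate vector of \<open>n\<close> by its content, and take a multiple of a coordinate
  function that is a unit on the quotient.
\<close>

lemma split_off_fps_X_power:
  assumes fg: "fin_gen_module fps_ring M" and n: "n \<in> carrier M" "n \<noteq> \<zero>\<^bsub>M\<^esub>"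
  obtains k n' \<phi> where "n' \<in> carrier M" "n = (fps_X ^ k) \<odot>\<^bsub>M\<^esub> n'"
    "\<phi> \<in> mod_hom fps_ring M (self_module fps_ring)" "\<phi> n' = 1"
proof -
  obtain B where "basis B" using basis_exists[OF fg] by blast
  then have fin: "finite B" and BM: "B \<subseteq> carrier M"
    and gen: "\<forall>m\<in>carrier M. \<exists>c. m = (\<Oplus>\<^bsub>M\<^esub>b\<in>B. c b \<odot>\<^bsub>M\<^esub> b)"
    and indep: "\<forall>c. (\<Oplus>\<^bsub>M\<^esub>b\<in>B. c b \<odot>\<^bsub>M\<^esub> b) = \<zero>\<^bsub>M\<^esub> \<longrightarrow> (\<forall>b\<in>B. c b = 0)"
    unfolding basis_def by blast+
  define E where "E c = (\<Oplus>\<^bsub>M\<^esub>b\<in>B. c b \<odot>\<^bsub>M\<^esub> b)" for c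
  have cl: "c b \<odot>\<^bsub>M\<^esub> b \<in> carrier M" if "b \<in> B" for b and c :: "'b \<Rightarrow> 'k fps" using that BM by auto
  have EM: "E c \<in> carrier M" for c unfolding E_def using cl by (intro M.finsum_closed) auto
  have Eadd: "E c \<oplus>\<^bsub>M\<^esub> E d = E (\<lambda>b. c b + d b)" for c d
  proof -
    have "E c \<oplus>\<^bsub>M\<^esub> E d = (\<Oplus>\<^bsub>M\<^esub>b\<in>B. c b \<odot>\<^bsub>M\<^esub> b \<oplus>\<^bsub>M\<^esub> d b \<odot>\<^bsub>M\<^esub> b)"
      unfolding E_def using cl by (intro M.finsum_addf[symmetric]) auto
    also have "\<dots> = E (\<lambda>b. c b + d b)" unfolding E_def
    proof (rule M.finsum_cong')
      fix b assume "b \<in> B"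
      then show "c b \<odot>\<^bsub>M\<^esub> b \<oplus>\<^bsub>M\<^esub> d b \<odot>\<^bsub>M\<^esub> b = (c b + d b) \<odot>\<^bsub>M\<^esub> b"
        using smult_l_distr[of "c b" "d b" b] BM by auto
    qed (use cl in auto)
    finally show ?thesis .
  qed
  have Esmult: "a \<odot>\<^bsub>M\<^esub> E c = E (\<lambda>b. a * c b)" for a c
  proof -
    have "a \<odot>\<^bsub>M\<^esub> E c = (\<Oplus>\<^bsub>M\<^esub>b\<in>B. a \<odot>\<^bsub>M\<^esub> (c b \<odot>\<^bsub>M\<^esub> b))"
      unfolding E_def using fin cl by (intro finsum_smult_ldistr) auto
    also have "\<dots> = E (\<lambda>b. a * c b)" unfolding E_def
    proof (rule M.finsum_cong')
      fix b assume "b \<in> B"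
      then show "a \<odot>\<^bsub>M\<^esub> (c b \<odot>\<^bsub>M\<^esub> b) = (a * c b) \<odot>\<^bsub>M\<^esub> b"
        using smult_assoc1[of a "c b" b] BM by auto
    qed (use cl in auto)
    finally show ?thesis .
  qed
  have Einj: "c b = d b" if "E c = E d" "b \<in> B" for c d b
  proof -
    have "E (\<lambda>b. c b + - 1 * d b) = E c \<oplus>\<^bsub>M\<^esub> E (\<lambda>b. - 1 * d b)" by (rule Eadd[symmetric])
    also have "E (\<lambda>b. - 1 * d b) = (- 1) \<odot>\<^bsub>M\<^esub> E d" by (rule Esmult[symmetric])
    also have "E c = 1 \<odot>\<^bsub>M\<^esub> E d" using smult_one[OF EM[of d]] that(1) by simp
    also have "1 \<odot>\<^bsub>M\<^esub> E d \<oplus>\<^bsub>M\<^esub> (- 1) \<odot>\<^bsub>M\<^esub> E d = (1 + - 1) \<odot>\<^bsub>M\<^esub> E d"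
      using smult_l_distr[of 1 "-1" "E d"] EM by simp
    also have "\<dots> = \<zero>\<^bsub>M\<^esub>" using smult_l_null[OF EM[of d]] by simp
    finally have "c b + - 1 * d b = 0" using indep[rule_format, of "\<lambda>b. c b + - 1 * d b"] that(2) unfolding E_def by blast
    then show ?thesis by simp
  qed
  obtain c where c: "n = E c" using gen n(1) unfolding E_def by auto
  have "\<exists>b\<in>B. c b \<noteq> 0"
  proof (rule ccontr)
    assume "\<not> ?thesis"
    then have "E c = (\<Oplus>\<^bsub>M\<^esub>b\<in>B. \<zero>\<^bsub>M\<^esub>)"
      unfolding E_def using BM smult_l_null by (intro M.finsum_cong') auto
    then show False using n(2) c by simp
  qed
  then obtain b where "b \<in> B" "c b \<noteq> 0" by blast
  then obtain k d t where t: "t \<in> B" "fps_nth (d t) 0 \<noteq> 0"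
    and d: "\<forall>s\<in>B. c s = fps_X ^ k * d s"
    by (rule fps_vector_content)
  define coord where "coord m = (SOME c. m = E c)" for m
  have coord: "m = E (coord m)" if "m \<in> carrier M" for m
  proof -
    have "\<exists>c. m = E c" using gen that unfolding E_def by blast
    then show ?thesis unfolding coord_def by (rule someI_ex)
  qed
  define \<phi> where "\<phi> m = inverse (d t) * coord m t" for m
  have \<phi>: "\<phi> m = inverse (d t) * e t" if "m = E e" for m e
    using Einj[of "coord m" e t] coord[of m] that EM[of e] t(1) by (simp add: \<phi>_def)
  show thesis
  proof (rule that[of "E d" k \<phi>])
    show "n = (fps_X ^ k) \<odot>\<^bsub>M\<^esub> E d"
      unfolding c E_def by (rule finsum_smult_fps_X_power[OF fin BM bspec[OF d]])
    show "\<phi> (E d) = 1" using \<phi>[OF refl, of d] inverse_mult_eq_1[OF t(2)] by simp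
    show "\<phi> \<in> mod_hom fps_ring M (self_module fps_ring)"
    proof (rule mod_homI)
      fix m m' assume m: "m \<in> carrier M" "m' \<in> carrier M"
      have "m \<oplus>\<^bsub>M\<^esub> m' = E (\<lambda>b. coord m b + coord m' b)" using coord m Eadd by metis
      then show "\<phi> (m \<oplus>\<^bsub>M\<^esub> m') = \<phi> m \<oplus>\<^bsub>self_module fps_ring\<^esub> \<phi> m'"
        by (subst \<phi>) (auto simp: \<phi>_def self_module_def algebra_simps)
    next
      fix a m assume m: "m \<in> carrier M"
      have "a \<odot>\<^bsub>M\<^esub> m = E (\<lambda>b. a * coord m b)" using coord m Esmult by metis
      then show "\<phi> (a \<odot>\<^bsub>M\<^esub> m) = a \<odot>\<^bsub>self_module fps_ring\<^esub> \<phi> m"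
        by (subst \<phi>) (auto simp: \<phi>_def self_module_def algebra_simps)
    qed (simp add: self_module_def)
  qed (rule EM)
qed

end

section \<open>Regular sequences\<close>

lemma (in module) zero_submodule: "submodule {\<zero>\<^bsub>M\<^esub>} R M"
  by (rule submoduleI) auto

lemma (in module) ideal_smult_empty: "ideal_smult R M (Idl {}) = {\<zero>\<^bsub>M\<^esub>}"
proof
  have "Idl {} \<subseteq> {\<zero>}" by (rule R.genideal_minimal[OF R.zeroideal]) simp
  then show "ideal_smult R M (Idl {}) \<subseteq> {\<zero>\<^bsub>M\<^esub>}"
    unfolding ideal_smult_def by (intro submodule_span_least zero_submodule) auto
next
  have "Idl {} \<subseteq> carrier R"
    by (rule additive_subgroup.a_subset[OF ideal.axioms(1)[OF R.genideal_ideal]]) simp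
  then have "submodule (ideal_smult R M (Idl {})) R M"
    by (rule ideal_smult_submodule[OF module_axioms])
  then show "{\<zero>\<^bsub>M\<^esub>} \<subseteq> ideal_smult R M (Idl {})"
    by (auto simp: submodule_def dest: subgroup.one_closed)
qed

lemma (in module) ideal_smult_carrier: "ideal_smult R M (carrier R) = carrier M"
proof
  show "ideal_smult R M (carrier R) \<subseteq> carrier M"
    by (rule submoduleE(1)[OF ideal_smult_submodule[OF module_axioms]]) simp
  show "carrier M \<subseteq> ideal_smult R M (carrier R)"
  proof
    fix m assume "m \<in> carrier M"
    then have "m \<in> {a \<odot>\<^bsub>M\<^esub> m | a m. a \<in> carrier R \<and> m \<in> carrier M}"
      by (intro CollectI exI[of _ \<one>] exI[of _ m]) auto
    then show "m \<in> ideal_smult R M (carrier R)"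
      unfolding ideal_smult_def by (rule subsetD[OF submodule_span_superset])
  qed
qed

lemma (in module) regular_sequence_no_unit:
  assumes "regular_sequence R M xs" "r \<in> set xs" "s \<in> carrier R"
  shows "s \<otimes> r \<noteq> \<one>"
proof
  assume *: "s \<otimes> r = \<one>"
  have xs: "set xs \<subseteq> carrier R" using assms(1) unfolding regular_sequence_def by auto
  interpret I: ideal "Idl (set xs)" R by (rule R.genideal_ideal[OF xs])
  have "r \<in> Idl (set xs)" using R.genideal_self[OF xs] assms(2) by auto
  then have "\<one> \<in> Idl (set xs)" using I.I_l_closed[of r s] assms(3) * by simp
  then have "Idl (set xs) = carrier R" by (rule I.one_imp_carrier)
  then show False using assms(1) ideal_smult_carrier unfolding regular_sequence_def by simp
qed

lemma (in module) regular_sequence_hd_nonzerodivisor: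
  assumes xs: "regular_sequence R M (r # rs)"
    and m: "m \<in> carrier M" "r \<odot>\<^bsub>M\<^esub> m = \<zero>\<^bsub>M\<^esub>"
  shows "m = \<zero>\<^bsub>M\<^esub>"
proof -
  have r: "r \<in> carrier R" using xs unfolding regular_sequence_def by auto
  have "\<forall>i<length (r # rs). nonzerodivisor_on
      (quot_module M (ideal_smult R M (Idl (set (take i (r # rs)))))) ((r # rs) ! i)"
    using xs unfolding regular_sequence_def by blast
  from this[rule_format, of 0] have "nonzerodivisor_on (quot_module M {\<zero>\<^bsub>M\<^esub>}) r"
    by (simp add: ideal_smult_empty)
  then show ?thesis using m nonzerodivisor_on_quot_module[OF module_axioms zero_submodule r] by simp
qed

section \<open>The ring \<open>k\<lbrakk>x\<rbrakk>[y]/(y\<^sup>2)\<close>\<close>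

text \<open>
  The ring is free over \<open>k\<lbrakk>x\<rbrakk>\<close> with basis \<open>1, y\<close>, and \<open>y\<^sup>2 = 0\<close>.  The locale records this in terms
  of the bijection \<open>el\<close>, where \<open>el a b\<close> stands for \<open>a + b y\<close>; this replaces computations with
  cosets by computations with pairs of power series.
\<close>

locale dual_fps_ring = cring R for R :: "('r, 'c) ring_scheme" (structure) +
  fixes el :: "'k::field fps \<Rightarrow> 'k fps \<Rightarrow> 'r"
  assumes carrier_iff: "r \<in> carrier R \<longleftrightarrow> (\<exists>a b. r = el a b)"
    and el_eq_iff [simp]: "el a b = el c d \<longleftrightarrow> a = c \<and> b = d"
    and el_add [simp]: "el a b \<oplus> el c d = el (a + c) (b + d)"
    and el_mult [simp]: "el a b \<otimes> el c d = el (a * c) (a * d + b * c)"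
    and el_one: "\<one> = el 1 0"
begin

lemma el_closed [simp]: "el a b \<in> carrier R" using carrier_iff by auto

lemma el_zero: "\<zero> = el 0 0"
proof -
  have "el 0 0 \<oplus> el 0 0 = el 0 0" by simp
  then show ?thesis using add.l_cancel_one'[of "el 0 0" "el 0 0"] by simp
qed

lemma genideal_y: "Idl {el 0 1} = range (el 0)"
proof -
  have "el a b \<otimes> el 0 1 = el 0 a" for a b by simp
  then have "PIdl (el 0 1) = range (el 0)"
    unfolding cgenideal_def image_def using carrier_iff by (metis UNIV_I)
  then show ?thesis using cgenideal_eq_genideal[of "el 0 1"] by simp
qed

lemma el_unit:
  assumes "fps_nth a 0 \<noteq> 0"
  shows "el (inverse a) (- (b * inverse a * inverse a)) \<otimes> el a b = \<one>"
proof -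
  have "b * (a * inverse a) = b" using inverse_mult_eq_1'[OF assms] by simp
  then show ?thesis
    using inverse_mult_eq_1[OF assms] inverse_mult_eq_1'[OF assms] by (simp add: el_one algebra_simps)
qed

subsection \<open>Prime ideals\<close>

text \<open>
  The preimage of a prime ideal \<open>J\<close> of \<open>k\<lbrakk>x\<rbrakk>\<close> under the homomorphism that sends \<open>y\<close> to \<open>0\<close> is prime.
\<close>

lemma primeideal_lift:
  assumes zero: "0 \<in> J" and add: "\<And>a b. a \<in> J \<Longrightarrow> b \<in> J \<Longrightarrow> a + b \<in> J"
    and mult: "\<And>a b. a \<in> J \<Longrightarrow> b * a \<in> J" and one: "1 \<notin> J"
    and prime: "\<And>a b. a * b \<in> J \<Longrightarrow> a \<in> J \<or> b \<in> J"
  shows "primeideal {el a b | a b. a \<in> J} R" (is "primeideal ?P R")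
proof (rule primeidealI)
  have neg: "\<ominus> el a b = el (- a) (- b)" for a b
    by (rule minus_equality) (simp_all add: el_zero)
  show "ideal ?P R"
  proof (rule idealI)
    show "subgroup ?P (add_monoid R)"
    proof (rule add.subgroupI)
      show "?P \<noteq> {}" using zero by blast
      show "\<And>r. r \<in> ?P \<Longrightarrow> \<ominus> r \<in> ?P" using mult[of _ "-1"] by (auto simp: neg)
    qed (use add in auto)
  next
    fix r s assume r: "r \<in> ?P" and s: "s \<in> carrier R"
    obtain a b c d where ab: "r = el a b" "a \<in> J" and cd: "s = el c d"
      using r s carrier_iff by auto
    show "s \<otimes> r \<in> ?P" using mult[of a c] ab cd by auto
    then show "r \<otimes> s \<in> ?P" using r s m_comm[of r s] by auto
  qed (rule ring_axioms)
  have "\<one> \<notin> ?P" using one by (auto simp: el_one)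
  then show "carrier R \<noteq> ?P" using one_closed by metis
  fix r s assume r: "r \<in> carrier R" and s: "s \<in> carrier R" and rs: "r \<otimes> s \<in> ?P"
  obtain a b c d where "r = el a b" "s = el c d" using r s carrier_iff by metis
  then show "r \<in> ?P \<or> s \<in> ?P" using rs prime[of a c] by auto
qed (rule is_cring)

lemma primeideal_y: "primeideal (range (el 0)) R"
  and primeideal_xy: "primeideal {el a b | a b. fps_nth a 0 = 0} R"
proof -
  have "range (el 0) = {el a b | a b. a \<in> {0}}" by auto
  then show "primeideal (range (el 0)) R" using primeideal_lift[of "{0}"] by auto
  show "primeideal {el a b | a b. fps_nth a 0 = 0} R"
    using primeideal_lift[of "{a. fps_nth a 0 = 0}"] by auto
qed

text \<open>
  A prime ideal contains the nilpotent \<open>y\<close>.  As soon as it contains an \<open>a + b y\<close> with \<open>a \<noteq> 0\<close>,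
  it contains \<open>a\<close>, which is a unit times a power of \<open>x\<close>, and hence \<open>x\<close>.
\<close>

lemma primeideal_cases:
  assumes "primeideal P R"
  shows "P = range (el 0) \<or> P = {el a b | a b. fps_nth a 0 = 0}"
proof -
  interpret primeideal P R by fact
  have P: "P \<subseteq> carrier R" by (rule a_subset)
  have "el 0 1 \<otimes> el 0 1 \<in> P" using additive_subgroup.zero_closed[OF is_additive_subgroup]
    by (simp add: el_zero)
  then have "el 0 1 \<in> P" using I_prime[of "el 0 1" "el 0 1"] by auto
  then have y: "el 0 b \<in> P" for b using I_l_closed[of "el 0 1" "el b 0"] by simp
  have nonunit: "fps_nth a 0 = 0" if "el a b \<in> P" for a b
  proof (rule ccontr)
    assume "fps_nth a 0 \<noteq> 0"
    then have "\<one> \<in> P" using I_l_closed[OF that] el_unit[of a b] by (metis el_closed)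
    then show False using one_imp_carrier I_notcarr by auto
  qed
  show ?thesis
  proof (cases "P \<subseteq> range (el 0)")
    case True
    then show ?thesis using y by auto
  next
    case False
    then obtain r where r: "r \<in> P" "r \<notin> range (el 0)" by blast
    obtain a b where "r = el a b" using r(1) P carrier_iff[of r] by auto
    with r have ab: "el a b \<in> P" "a \<noteq> 0" by auto
    let ?u = "fps_shift (subdegree a) a"
    have u: "fps_nth ?u 0 \<noteq> 0" using ab(2) by simp
    have "el a b \<oplus> el 0 (- b) \<in> P" using ab(1) y by (rule a_closed)
    then have "el (inverse ?u) 0 \<otimes> el a 0 \<in> P" using I_l_closed[of "el a 0" "el (inverse ?u) 0"] by simp
    moreover have "inverse ?u * a = fps_X ^ subdegree a"
      using arg_cong[OF subdegree_decompose[of a], of "\<lambda>z. inverse ?u * z"] inverse_mult_eq_1[OF u]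
      by (simp add: mult.assoc[symmetric])
    ultimately have "el (fps_X ^ subdegree a) 0 \<in> P" by simp
    moreover have "el (fps_X ^ k) 0 \<in> P \<Longrightarrow> el fps_X 0 \<in> P" for k
    proof (induction k)
      case 0
      then show ?case using nonunit[of 1 0] by simp
    next
      case (Suc k)
      have "el fps_X 0 \<otimes> el (fps_X ^ k) 0 \<in> P" using Suc.prems by simp
      then show ?case using I_prime[of "el fps_X 0" "el (fps_X ^ k) 0"] Suc.IH by auto
    qed
    ultimately have x: "el fps_X 0 \<in> P" by blast
    have "el c d \<in> P" if "fps_nth c 0 = 0" for c d
    proof -
      have "c = fps_shift 1 c * fps_X"
        using fps_X_times_fps_shift_1[OF that] by (simp add: mult.commute)
      moreover have "el (fps_shift 1 c) 0 \<otimes> el fps_X 0 \<oplus> el 0 d \<in> P"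
        using I_l_closed[OF x, of "el (fps_shift 1 c) 0"] y by (intro a_closed) auto
      ultimately show ?thesis by simp
    qed
    moreover have "r \<in> {el a b | a b. fps_nth a 0 = 0}" if r: "r \<in> P" for r
    proof -
      obtain a b where "r = el a b" using r P carrier_iff[of r] by auto
      then show ?thesis using nonunit r by blast
    qed
    ultimately have "P = {el a b | a b. fps_nth a 0 = 0}" by blast
    then show ?thesis ..
  qed
qed

text \<open>
  The prime ideals are \<open>(y)\<close> and \<open>(x, y)\<close>, and they form a chain.
\<close>

lemma krull_dim_eq_1: "krull_dim R = 1"
proof (rule antisym)
  show "krull_dim R \<le> 1"
    unfolding krull_dim_def
  proof (rule Sup_least)
    fix z assume "z \<in> {enat n | n. \<exists>P :: nat \<Rightarrow> 'r set.
           (\<forall>i\<le>n. primeideal (P i) R) \<and> (\<forall>i<n. P i \<subset> P (Suc i))}"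
    then obtain n P where z: "z = enat n" and P: "\<And>i. i \<le> n \<Longrightarrow> primeideal (P i) R"
      and lt: "\<And>i. i < n \<Longrightarrow> P i \<subset> P (Suc i)" by blast
    have "\<not> 2 \<le> n"
    proof
      assume n: "2 \<le> n"
      then have "P 0 \<subset> P 1" "P 1 \<subset> P 2" using lt[of 0] lt[of 1] by (auto simp: numeral_2_eq_2)
      then have "P 0 \<noteq> P 1" "P 1 \<noteq> P 2" "P 0 \<noteq> P 2" by auto
      then show False
        using primeideal_cases[OF P[of 0]] primeideal_cases[OF P[of 1]] primeideal_cases[OF P[of 2]] n
        by auto
    qed
    then show "z \<le> 1" unfolding z one_enat_def by simp
  qed
  define P where "P i = (if i = 0 then range (el 0) else {el a b | a b. fps_nth a 0 = 0})" for i :: nat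
  have "P 0 \<subset> P (Suc 0)"
  proof -
    have "el fps_X 0 \<in> P (Suc 0)" "el fps_X 0 \<notin> P 0" unfolding P_def by auto
    moreover have "P 0 \<subseteq> P (Suc 0)" unfolding P_def by auto
    ultimately show ?thesis by blast
  qed
  then have "\<exists>P :: nat \<Rightarrow> 'r set. (\<forall>i\<le>1. primeideal (P i) R) \<and> (\<forall>i<1. P i \<subset> P (Suc i))"
    using primeideal_y primeideal_xy by (intro exI[of _ P]) (auto simp: P_def)
  then show "1 \<le> krull_dim R"
    unfolding krull_dim_def one_enat_def by (intro Sup_upper) blast
qed

subsection \<open>The maximal Cohen-Macaulay module \<open>R/(y)\<close>\<close>

definition coeff0 :: "'r \<Rightarrow> 'k fps"
  where "coeff0 r = (THE a. \<exists>b. r = el a b)"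

lemma coeff0_el [simp]: "coeff0 (el a b) = a"
  unfolding coeff0_def by auto

text \<open>
  Up to isomorphism \<open>R/(y)\<close> is \<open>k\<lbrakk>x\<rbrakk>\<close>, on which \<open>y\<close> acts as zero.
\<close>

definition mod_y :: "('r, 'k fps) module"
  where "mod_y = \<lparr>carrier = UNIV, monoid.mult = (*), one = 1, ring.zero = 0, add = (+),
    module.smult = (\<lambda>r m. coeff0 r * m)\<rparr>"

lemma mod_y_simps [simp]:
  "carrier mod_y = UNIV" "\<zero>\<^bsub>mod_y\<^esub> = 0" "m \<oplus>\<^bsub>mod_y\<^esub> n = m + n" "el a b \<odot>\<^bsub>mod_y\<^esub> m = a * m"
  by (simp_all add: mod_y_def)

lemma module_mod_y: "module R mod_y"
proof (rule moduleI)
  show "abelian_group mod_y"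
    by (rule abelian_groupI) (auto simp: algebra_simps intro: exI[of _ "- _"] left_minus)
qed (auto simp: carrier_iff el_one algebra_simps is_cring)

lemma ideal_smult_mod_y: "ideal_smult R mod_y (Idl {el a b}) = range ((*) a)"
proof
  interpret Y: module R mod_y by (rule module_mod_y)
  have sub: "submodule (range ((*) a)) R mod_y"
  proof (rule Y.submoduleI)
    fix r m assume "r \<in> carrier R" "m \<in> range ((*) a)"
    then obtain c d z where "r = el c d" "m = a * z" using carrier_iff[of r] by blast
    then show "r \<odot>\<^bsub>mod_y\<^esub> m \<in> range ((*) a)" by (auto intro: range_eqI[of _ _ "c * z"])
  next
    fix m assume "m \<in> range ((*) a)"
    then obtain z where z: "m = a * z" by blast
    have "\<ominus>\<^bsub>mod_y\<^esub> m = a * (- z)" by (rule Y.minus_equality) (simp_all add: z)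
    then show "\<ominus>\<^bsub>mod_y\<^esub> m \<in> range ((*) a)" by blast
  next
    fix m n assume "m \<in> range ((*) a)" "n \<in> range ((*) a)"
    then obtain z w where "m = a * z" "n = a * w" by blast
    then have "m \<oplus>\<^bsub>mod_y\<^esub> n = a * (z + w)" by (simp add: algebra_simps)
    then show "m \<oplus>\<^bsub>mod_y\<^esub> n \<in> range ((*) a)" by blast
  qed (auto intro: range_eqI[of _ _ 0])
  have "r \<odot>\<^bsub>mod_y\<^esub> m \<in> range ((*) a)" if r: "r \<in> Idl {el a b}" for r m
  proof -
    have "r \<in> PIdl (el a b)" using r cgenideal_eq_genideal[of "el a b"] by simp
    then obtain s where s: "s \<in> carrier R" "r = s \<otimes> el a b" unfolding cgenideal_def by blast
    then obtain c d where "s = el c d" using carrier_iff[of s] by blast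
    then have "r \<odot>\<^bsub>mod_y\<^esub> m = a * (c * m)" using s(2) by (simp add: algebra_simps)
    then show ?thesis by blast
  qed
  then show "ideal_smult R mod_y (Idl {el a b}) \<subseteq> range ((*) a)"
    unfolding ideal_smult_def by (intro submodule_span_least[OF sub]) auto
  have "a * z \<in> {r \<odot>\<^bsub>mod_y\<^esub> m | r m. r \<in> Idl {el a b} \<and> m \<in> carrier mod_y}" for z
    using genideal_self[of "{el a b}"] by (intro CollectI exI[of _ "el a b"] exI[of _ z]) auto
  then show "range ((*) a) \<subseteq> ideal_smult R mod_y (Idl {el a b})"
    unfolding ideal_smult_def
    using submodule_span_superset[of "{r \<odot>\<^bsub>mod_y\<^esub> m | r m. r \<in> Idl {el a b} \<and> m \<in> carrier mod_y}" R mod_y]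
    by blast
qed

lemma regular_sequence_coeff:
  assumes "module R M" "regular_sequence R M xs" "el a b \<in> set xs"
  shows "fps_nth a 0 = 0"
  using module.regular_sequence_no_unit[OF assms el_closed] el_unit[of a b] by blast

lemma regular_sequence_mod_y: "regular_sequence R mod_y [el fps_X 0]"
proof -
  interpret Y: module R mod_y by (rule module_mod_y)
  have "(1 :: 'k fps) \<notin> range ((*) fps_X)"
  proof
    assume "(1 :: 'k fps) \<in> range ((*) fps_X)"
    then obtain z :: "'k fps" where "1 = fps_X * z" by blast
    from arg_cong[OF this, of "\<lambda>f. fps_nth f 0"] show False by simp
  qed
  then have "ideal_smult R mod_y (Idl (set [el fps_X 0])) \<noteq> carrier mod_y"
    by (auto simp: ideal_smult_mod_y)
  moreover have "nonzerodivisor_on (quot_module mod_y (ideal_smult R mod_y (Idl {}))) (el fps_X 0)"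
    unfolding Y.ideal_smult_empty
    by (subst nonzerodivisor_on_quot_module[OF module_mod_y Y.zero_submodule]) auto
  ultimately show ?thesis unfolding regular_sequence_def by auto
qed

text \<open>
  Let \<open>a\<close> and \<open>c\<close> be the power series by which the first two entries act on \<open>k\<lbrakk>x\<rbrakk>\<close>.  Both are
  divisible by \<open>x\<close>, and \<open>a \<noteq> 0\<close>.  Then \<open>a/x\<close> is nonzero modulo \<open>a\<close>, but \<open>c\<close> kills it there.
\<close>

lemma regular_sequence_mod_y_length:
  assumes xs: "regular_sequence R mod_y xs"
  shows "length xs \<le> 1"
proof (rule ccontr)
  interpret Y: module R mod_y by (rule module_mod_y)
  assume "\<not> length xs \<le> 1"
  then obtain r s rs where rs: "xs = r # s # rs" by (cases xs; cases "tl xs") auto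
  have "r \<in> carrier R" "s \<in> carrier R" using xs unfolding regular_sequence_def rs by auto
  then obtain a b c d where r: "r = el a b" and s: "s = el c d" using carrier_iff by metis
  have a0: "fps_nth a 0 = 0" and c0: "fps_nth c 0 = 0"
    using regular_sequence_coeff[OF module_mod_y xs] unfolding rs r s by auto
  have "a \<noteq> 0"
    using Y.regular_sequence_hd_nonzerodivisor[of r "s # rs" 1] xs unfolding rs r by auto
  define a' where "a' = fps_shift 1 a"
  have a': "a = fps_X * a'" unfolding a'_def using fps_X_times_fps_shift_1[OF a0] by simp
  have "nonzerodivisor_on (quot_module mod_y (range ((*) a))) s"
  proof -
    have "\<forall>i<length xs. nonzerodivisor_on
        (quot_module mod_y (ideal_smult R mod_y (Idl (set (take i xs))))) (xs ! i)"
      using xs unfolding regular_sequence_def by blast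
    from this[rule_format, of 1] show ?thesis unfolding rs r by (simp add: ideal_smult_mod_y)
  qed
  moreover have "submodule (range ((*) a)) R mod_y"
    unfolding ideal_smult_mod_y[of a b, symmetric]
    by (rule ideal_smult_submodule[OF module_mod_y
          additive_subgroup.a_subset[OF ideal.axioms(1)[OF genideal_ideal]]]) simp
  moreover have "s \<odot>\<^bsub>mod_y\<^esub> a' \<in> range ((*) a)"
  proof -
    have "c * a' = fps_X * fps_shift 1 c * a'" using fps_X_times_fps_shift_1[OF c0] by simp
    also have "\<dots> = a * fps_shift 1 c" unfolding a' by (simp add: algebra_simps)
    finally show ?thesis unfolding s by auto
  qed
  ultimately have "a' \<in> range ((*) a)"
    using nonzerodivisor_on_quot_module[OF module_mod_y, of "range ((*) a)" s] by (simp add: s)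
  then obtain z where "a' = fps_X * a' * z" unfolding a' by blast
  then have "a' * 1 = a' * (fps_X * z)" by (simp add: algebra_simps)
  moreover have "a' \<noteq> 0" using \<open>a \<noteq> 0\<close> a' by auto
  ultimately have "1 = fps_X * z" by (metis mult_left_cancel)
  from arg_cong[OF this, of "\<lambda>f. fps_nth f 0"] show False by simp
qed

lemma MCM_mod_y: "MCM_module R mod_y"
proof -
  interpret Y: module R mod_y by (rule module_mod_y)
  have "module_depth R mod_y = 1"
    unfolding module_depth_def
  proof (rule antisym)
    show "(SUP xs\<in>{xs. regular_sequence R mod_y xs}. enat (length xs)) \<le> 1"
      using regular_sequence_mod_y_length by (intro SUP_least) (auto simp: one_enat_def)
    show "1 \<le> (SUP xs\<in>{xs. regular_sequence R mod_y xs}. enat (length xs))"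
      using regular_sequence_mod_y by (intro SUP_upper2[of "[el fps_X 0]"]) (auto simp: one_enat_def)
  qed
  moreover have "fin_gen_module R mod_y"
  proof -
    have sub: "submodule (submodule_span R mod_y {1}) R mod_y"
      by (rule submodule_span_submodule[OF module_mod_y]) simp
    have "1 \<in> submodule_span R mod_y {1}" using submodule_span_superset[of "{1}" R mod_y] by blast
    then have "el m 0 \<odot>\<^bsub>mod_y\<^esub> 1 \<in> submodule_span R mod_y {1}" for m
      by (intro Y.submoduleE(4)[OF sub]) simp_all
    then have "submodule_span R mod_y {1} = carrier mod_y" by auto
    then show ?thesis unfolding fin_gen_module_def by (intro exI[of _ "{1}"]) auto
  qed
  moreover have "carrier mod_y \<noteq> {\<zero>\<^bsub>mod_y\<^esub>}" 
    using UNIV_I[of "1 :: 'k fps"] by (metis mod_y_simps(1,2) singletonD zero_neq_one)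
  ultimately show ?thesis using module_mod_y krull_dim_eq_1 unfolding MCM_module_def by simp
qed

text \<open>
  Since \<open>y\<close> acts as zero on \<open>R/(y)\<close>, every homomorphism from \<open>R/(y)\<close> to \<open>R\<close> takes its values in
  the annihilator of \<open>y\<close>, which is \<open>(y)\<close>.
\<close>

lemma tau_mod_y: "tau R mod_y \<subseteq> Idl {el 0 1}"
  unfolding tau_def
proof (rule genideal_minimal)
  show "ideal (Idl {el 0 1}) R" by (rule genideal_ideal) simp
  show "(\<Union>f\<in>mod_hom R mod_y (self_module R). f ` carrier mod_y) \<subseteq> Idl {el 0 1}"
  proof clarify
    fix f m assume f: "f \<in> mod_hom R mod_y (self_module R)"
    have "f m \<in> carrier R" using mod_homD(1)[OF f] by (simp add: self_module_def)
    then obtain p q where pq: "f m = el p q" using carrier_iff by auto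
    have "f (el a b \<odot>\<^bsub>mod_y\<^esub> m) = el a b \<otimes> f m" for a b
      using mod_homD(3)[OF f, of "el a b" m] by (simp add: self_module_def)
    from this[of 0 1] this[of 0 0] have "el 0 1 \<otimes> f m = el 0 0 \<otimes> f m" by simp
    then show "f m \<in> Idl {el 0 1}" unfolding pq genideal_y by simp
  qed
qed

subsection \<open>Maximal Cohen-Macaulay modules are free over \<open>k\<lbrakk>x\<rbrakk>\<close>\<close>

text \<open>
  Restriction of scalars along the inclusion of \<open>k\<lbrakk>x\<rbrakk>\<close> into \<open>R\<close>.
\<close>

definition over_fps :: "('r, 'b, 'd) module_scheme \<Rightarrow> ('k fps, 'b) module"
  where "over_fps M = \<lparr>carrier = carrier M, monoid.mult = undefined, one = undefined,
    ring.zero = \<zero>\<^bsub>M\<^esub>, add = add M, module.smult = (\<lambda>a m. el a 0 \<odot>\<^bsub>M\<^esub> m)\<rparr>"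

lemma over_fps_simps [simp]:
  "carrier (over_fps M) = carrier M" "\<zero>\<^bsub>over_fps M\<^esub> = \<zero>\<^bsub>M\<^esub>" "m \<oplus>\<^bsub>over_fps M\<^esub> n = m \<oplus>\<^bsub>M\<^esub> n"
  "a \<odot>\<^bsub>over_fps M\<^esub> m = el a 0 \<odot>\<^bsub>M\<^esub> m"
  by (simp_all add: over_fps_def)

lemma module_over_fps:
  assumes "module R M"
  shows "module fps_ring (over_fps M)"
proof -
  interpret M: module R M by fact
  show ?thesis
  proof (rule moduleI)
    show "cring (fps_ring :: 'k fps ring)" by (rule cring_from_type_algebra)
    show "abelian_group (over_fps M)"
    proof (rule abelian_groupI)
      fix m assume "m \<in> carrier (over_fps M)"
      then show "\<exists>n\<in>carrier (over_fps M). n \<oplus>\<^bsub>over_fps M\<^esub> m = \<zero>\<^bsub>over_fps M\<^esub>"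
        by (intro bexI[of _ "\<ominus>\<^bsub>M\<^esub> m"]) (auto simp: M.l_neg)
    qed (auto simp: M.a_ac)
  next
    fix a b m assume "m \<in> carrier (over_fps M)"
    then show "(a \<oplus>\<^bsub>fps_ring\<^esub> b) \<odot>\<^bsub>over_fps M\<^esub> m = a \<odot>\<^bsub>over_fps M\<^esub> m \<oplus>\<^bsub>over_fps M\<^esub> b \<odot>\<^bsub>over_fps M\<^esub> m"
      and "(a \<otimes>\<^bsub>fps_ring\<^esub> b) \<odot>\<^bsub>over_fps M\<^esub> m = a \<odot>\<^bsub>over_fps M\<^esub> (b \<odot>\<^bsub>over_fps M\<^esub> m)"
      using M.smult_l_distr[of "el a 0" "el b 0" m] M.smult_assoc1[of "el a 0" "el b 0" m] by simp_all
  next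
    fix m assume "m \<in> carrier (over_fps M)"
    then show "\<one>\<^bsub>fps_ring\<^esub> \<odot>\<^bsub>over_fps M\<^esub> m = m" using M.smult_one[of m] by (simp add: el_one)
  qed (auto simp: M.smult_r_distr)
qed

lemma smult_el:
  assumes "module R M" "m \<in> carrier M"
  shows "el a b \<odot>\<^bsub>M\<^esub> m = el a 0 \<odot>\<^bsub>M\<^esub> m \<oplus>\<^bsub>M\<^esub> el b 0 \<odot>\<^bsub>M\<^esub> (el 0 1 \<odot>\<^bsub>M\<^esub> m)"
proof -
  interpret M: module R M by fact
  show ?thesis
    using M.smult_l_distr[of "el a 0" "el 0 b" m] M.smult_assoc1[of "el b 0" "el 0 1" m] assms(2)
    by simp
qed

text \<open>
  As \<open>R\<close> is generated by \<open>1\<close> and \<open>y\<close> over \<open>k\<lbrakk>x\<rbrakk>\<close>, generators of \<open>M\<close> over \<open>R\<close> together with their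
  multiples by \<open>y\<close> generate \<open>M\<close> over \<open>k\<lbrakk>x\<rbrakk>\<close>.
\<close>

lemma fin_gen_over_fps:
  assumes M: "module R M" and fg: "fin_gen_module R M"
  shows "fin_gen_module fps_ring (over_fps M)"
proof -
  interpret M: module R M by fact
  interpret F: module fps_ring "over_fps M" by (rule module_over_fps[OF M])
  obtain A where A: "finite A" "A \<subseteq> carrier M" "submodule_span R M A = carrier M"
    using fg unfolding fin_gen_module_def by auto
  define T where "T = A \<union> (\<lambda>m. el 0 1 \<odot>\<^bsub>M\<^esub> m) ` A"
  have T: "finite T" "T \<subseteq> carrier (over_fps M)" unfolding T_def using A by auto
  define N where "N = submodule_span fps_ring (over_fps M) T"
  have N: "submodule N fps_ring (over_fps M)"
    unfolding N_def by (rule submodule_span_submodule[OF F.module_axioms T(2)])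
  note NE = F.submoduleE[OF N, simplified]
  have TN: "T \<subseteq> N" unfolding N_def by (rule submodule_span_superset)
  have N0: "\<zero>\<^bsub>M\<^esub> \<in> N" using N by (auto simp: submodule_def dest: subgroup.one_closed)
  \<comment> \<open>The largest \<open>R\<close>-submodule contained in the \<open>k\<lbrakk>x\<rbrakk>\<close>-span \<open>N\<close>.\<close>
  define N' where "N' = {m \<in> N. el 0 1 \<odot>\<^bsub>M\<^esub> m \<in> N}"
  have N'D: "m \<in> carrier M" "m \<in> N" "el 0 1 \<odot>\<^bsub>M\<^esub> m \<in> N" if "m \<in> N'" for m
    using that NE(1) unfolding N'_def by auto
  have smult: "el a b \<odot>\<^bsub>M\<^esub> m \<in> N" if "m \<in> N'" for a b m
    unfolding smult_el[OF M N'D(1)[OF that], of a b] using N'D[OF that] NE(4,5) by auto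
  have "submodule N' R M"
  proof (rule M.submoduleI)
    show "N' \<subseteq> carrier M" using N'D(1) by auto
    show "\<zero>\<^bsub>M\<^esub> \<in> N'" unfolding N'_def using N0 by simp
  next
    fix m n assume mn: "m \<in> N'" "n \<in> N'"
    show "m \<oplus>\<^bsub>M\<^esub> n \<in> N'"
      unfolding N'_def
      using N'D[OF mn(1)] N'D[OF mn(2)] NE(5) M.smult_r_distr[of "el 0 1" m n] by auto
  next
    fix r m assume "r \<in> carrier R" and m: "m \<in> N'"
    then obtain a b where r: "r = el a b" using carrier_iff by auto
    have "el 0 1 \<odot>\<^bsub>M\<^esub> (el a b \<odot>\<^bsub>M\<^esub> m) = el 0 a \<odot>\<^bsub>M\<^esub> m"
      using M.smult_assoc1[of "el 0 1" "el a b" m] N'D(1)[OF m] by simp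
    then show "r \<odot>\<^bsub>M\<^esub> m \<in> N'" unfolding N'_def r using smult[OF m] by simp
  next
    fix m assume m: "m \<in> N'"
    have "\<ominus>\<^bsub>M\<^esub> m = el (- 1) 0 \<odot>\<^bsub>M\<^esub> m"
    proof (rule M.minus_equality)
      have "el (- 1) 0 \<odot>\<^bsub>M\<^esub> m \<oplus>\<^bsub>M\<^esub> \<one> \<odot>\<^bsub>M\<^esub> m = \<zero> \<odot>\<^bsub>M\<^esub> m"
        using M.smult_l_distr[of "el (- 1) 0" \<one> m] N'D(1)[OF m] by (simp add: el_one el_zero)
      then show "el (- 1) 0 \<odot>\<^bsub>M\<^esub> m \<oplus>\<^bsub>M\<^esub> m = \<zero>\<^bsub>M\<^esub>" using N'D(1)[OF m] by simp
    qed (use N'D(1)[OF m] in simp_all)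
    moreover have "el 0 1 \<odot>\<^bsub>M\<^esub> (el (- 1) 0 \<odot>\<^bsub>M\<^esub> m) = el 0 (- 1) \<odot>\<^bsub>M\<^esub> m"
      using M.smult_assoc1[of "el 0 1" "el (- 1) 0" m] N'D(1)[OF m] by simp
    ultimately show "\<ominus>\<^bsub>M\<^esub> m \<in> N'" unfolding N'_def using smult[OF m] by simp
  qed
  moreover have "A \<subseteq> N'" using TN unfolding N'_def T_def by auto
  ultimately have "carrier M \<subseteq> N'" using submodule_span_least A(3) by metis
  then have "N = carrier M" using N'D(2) NE(1) by auto
  then show ?thesis unfolding fin_gen_module_def using T N_def by auto
qed

text \<open>
  The first element \<open>a + b y\<close> of a regular sequence lies in the maximal ideal, so that \<open>x\<close> divides
  \<open>a\<close>.  As \<open>(a + b y)\<^sup>2 = a (a + 2 b y)\<close>, everything killed by \<open>x\<close> is killed by \<open>(a + b y)\<^sup>2\<close>.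
\<close>

lemma regular_sequence_fps_X_nonzerodivisor:
  assumes M: "module R M" and xs: "regular_sequence R M xs" "xs \<noteq> []"
    and m: "m \<in> carrier M" "el fps_X 0 \<odot>\<^bsub>M\<^esub> m = \<zero>\<^bsub>M\<^esub>"
  shows "m = \<zero>\<^bsub>M\<^esub>"
proof -
  interpret M: module R M by fact
  obtain r rs where rs: "xs = r # rs" using xs(2) by (cases xs) auto
  have "r \<in> carrier R" using xs(1) unfolding regular_sequence_def rs by auto
  then obtain a b where r: "r = el a b" using carrier_iff by auto
  note nzd = M.regular_sequence_hd_nonzerodivisor[OF xs(1)[unfolded rs r]]
  have "fps_nth a 0 = 0" using regular_sequence_coeff[OF M xs(1)] unfolding rs r by auto
  then obtain a' where a: "a = fps_X * a'" using fps_X_times_fps_shift_1 by metis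
  let ?s = "el (a' * a) (a' * (2 * b))"
  have "el a b \<otimes> el a b = ?s \<otimes> el fps_X 0" by (simp add: a algebra_simps)
  then have "el a b \<odot>\<^bsub>M\<^esub> (el a b \<odot>\<^bsub>M\<^esub> m) = ?s \<odot>\<^bsub>M\<^esub> (el fps_X 0 \<odot>\<^bsub>M\<^esub> m)"
    using M.smult_assoc1[of "el a b" "el a b" m] M.smult_assoc1[of ?s "el fps_X 0" m] m(1)
    by (metis el_closed)
  also have "\<dots> = \<zero>\<^bsub>M\<^esub>" using m(2) by simp
  finally show ?thesis using nzd m(1) by (metis M.smult_closed el_closed)
qed

lemma MCM_torsion_free:
  assumes "MCM_module R M"
  shows "torsion_free_fps_module (over_fps M)"
proof -
  have M: "module R M" and depth: "module_depth R M = 1"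
    using assms krull_dim_eq_1 unfolding MCM_module_def by auto
  have "\<exists>xs. regular_sequence R M xs \<and> xs \<noteq> []"
  proof (rule ccontr)
    assume *: "\<not> ?thesis"
    then have "module_depth R M \<le> 0"
      unfolding module_depth_def by (intro SUP_least) (auto simp: zero_enat_def)
    then show False using depth by simp
  qed
  then obtain xs where xs: "regular_sequence R M xs" "xs \<noteq> []" by blast
  interpret F: module fps_ring "over_fps M" by (rule module_over_fps[OF M])
  show ?thesis
    by unfold_locales (use regular_sequence_fps_X_nonzerodivisor[OF M xs] in auto)
qed

text \<open>
  A \<open>k\<lbrakk>x\<rbrakk>\<close>-linear functional \<open>\<phi>\<close> on \<open>M\<close> extends to the \<open>R\<close>-linear map
  \<open>m \<mapsto> \<phi> (y m) + \<phi> m y\<close> to \<open>R\<close>.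
\<close>

lemma functional_induces_mod_hom:
  assumes M: "module R M" and \<phi>: "\<phi> \<in> mod_hom fps_ring (over_fps M) (self_module fps_ring)"
  shows "(\<lambda>m. el (\<phi> (el 0 1 \<odot>\<^bsub>M\<^esub> m)) (\<phi> m)) \<in> mod_hom R M (self_module R)"
proof (rule mod_homI)
  interpret M: module R M by fact
  note hom = mod_homD[OF \<phi>, simplified, simplified self_module_def, simplified]
  show "el (\<phi> (el 0 1 \<odot>\<^bsub>M\<^esub> m)) (\<phi> m) \<in> carrier (self_module R)" for m by (simp add: self_module_def)
  show "el (\<phi> (el 0 1 \<odot>\<^bsub>M\<^esub> (m \<oplus>\<^bsub>M\<^esub> n))) (\<phi> (m \<oplus>\<^bsub>M\<^esub> n)) =
      el (\<phi> (el 0 1 \<odot>\<^bsub>M\<^esub> m)) (\<phi> m) \<oplus>\<^bsub>self_module R\<^esub> el (\<phi> (el 0 1 \<odot>\<^bsub>M\<^esub> n)) (\<phi> n)"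
    if "m \<in> carrier M" "n \<in> carrier M" for m n
    using that hom(2) by (simp add: self_module_def M.smult_r_distr)
  fix r m assume "r \<in> carrier R" and m: "m \<in> carrier M"
  then obtain a b where r: "r = el a b" using carrier_iff by auto
  have lin: "\<phi> (el c d \<odot>\<^bsub>M\<^esub> m) = c * \<phi> m + d * \<phi> (el 0 1 \<odot>\<^bsub>M\<^esub> m)" for c d
    unfolding smult_el[OF M m, of c d] using hom(2,3) m by simp
  have "el 0 1 \<odot>\<^bsub>M\<^esub> (el a b \<odot>\<^bsub>M\<^esub> m) = el 0 a \<odot>\<^bsub>M\<^esub> m"
    using M.smult_assoc1[of "el 0 1" "el a b" m] m by simp
  then show "el (\<phi> (el 0 1 \<odot>\<^bsub>M\<^esub> (r \<odot>\<^bsub>M\<^esub> m))) (\<phi> (r \<odot>\<^bsub>M\<^esub> m)) =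
      r \<odot>\<^bsub>self_module R\<^esub> el (\<phi> (el 0 1 \<odot>\<^bsub>M\<^esub> m)) (\<phi> m)"
    unfolding r by (simp add: lin[of 0 a] lin[of a b] self_module_def)
qed

lemma tau_ideal: "ideal (tau R M) R"
  unfolding tau_def
  by (rule genideal_ideal) (use mod_homD(1)[of _ R M "self_module R"] in \<open>auto simp: self_module_def\<close>)

lemma mod_hom_value_in_tau:
  assumes "f \<in> mod_hom R M (self_module R)" "m \<in> carrier M"
  shows "f m \<in> tau R M"
proof -
  have "(\<Union>f\<in>mod_hom R M (self_module R). f ` carrier M) \<subseteq> carrier R"
    using mod_homD(1)[of _ R M "self_module R"] by (auto simp: self_module_def)
  from genideal_self[OF this] show ?thesis unfolding tau_def using assms by blast
qed

text \<open>
  As \<open>y\<close> is nilpotent, it kills some nonzero \<open>n \<in> M\<close>.  Dividing \<open>n\<close> by a power of \<open>x\<close>, which keeps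
  it in the kernel of the multiplication by \<open>y\<close>, yields an \<open>n'\<close> with \<open>y n' = 0\<close> and a functional
  \<open>\<phi>\<close> with \<open>\<phi> n' = 1\<close>.  The \<open>R\<close>-linear map induced by \<open>\<phi>\<close> sends \<open>n'\<close> to \<open>y\<close>.
\<close>

lemma MCM_y_in_tau:
  assumes "MCM_module R M"
  shows "el 0 1 \<in> tau R M"
proof -
  have M: "module R M" and fg: "fin_gen_module R M" and nz: "carrier M \<noteq> {\<zero>\<^bsub>M\<^esub>}"
    using assms unfolding MCM_module_def by auto
  interpret M: module R M by fact
  interpret F: torsion_free_fps_module "over_fps M" by (rule MCM_torsion_free[OF assms])
  \<comment> \<open>If \<open>y m \<noteq> 0\<close>, then \<open>n = y m\<close> is killed by \<open>y\<close>.\<close>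
  obtain n where n: "n \<in> carrier M" "n \<noteq> \<zero>\<^bsub>M\<^esub>" "el 0 1 \<odot>\<^bsub>M\<^esub> n = \<zero>\<^bsub>M\<^esub>"
  proof -
    obtain m where m: "m \<in> carrier M" "m \<noteq> \<zero>\<^bsub>M\<^esub>" using nz M.zero_closed by blast
    have "el 0 1 \<odot>\<^bsub>M\<^esub> (el 0 1 \<odot>\<^bsub>M\<^esub> m) = \<zero> \<odot>\<^bsub>M\<^esub> m"
      using M.smult_assoc1[of "el 0 1" "el 0 1" m] m by (simp add: el_zero)
    then have "el 0 1 \<odot>\<^bsub>M\<^esub> (el 0 1 \<odot>\<^bsub>M\<^esub> m) = \<zero>\<^bsub>M\<^esub>" using m by simp
    then show thesis
      using m that[of m] that[of "el 0 1 \<odot>\<^bsub>M\<^esub> m"] by (cases "el 0 1 \<odot>\<^bsub>M\<^esub> m = \<zero>\<^bsub>M\<^esub>") simp_all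
  qed
  obtain k n' \<phi> where n': "n' \<in> carrier (over_fps M)" "n = (fps_X ^ k) \<odot>\<^bsub>over_fps M\<^esub> n'"
    and \<phi>: "\<phi> \<in> mod_hom fps_ring (over_fps M) (self_module fps_ring)" "\<phi> n' = 1"
    by (rule F.split_off_fps_X_power[OF fin_gen_over_fps[OF M fg]]) (use n(1,2) in simp_all)
  have n'M: "n' \<in> carrier M" using n'(1) by simp
  have "(fps_X ^ k) \<odot>\<^bsub>over_fps M\<^esub> (el 0 1 \<odot>\<^bsub>M\<^esub> n') = el 0 1 \<odot>\<^bsub>M\<^esub> n"
    using M.smult_assoc1[of "el (fps_X ^ k) 0" "el 0 1" n']
      M.smult_assoc1[of "el 0 1" "el (fps_X ^ k) 0" n'] n'M n'(2) by simp
  then have y: "el 0 1 \<odot>\<^bsub>M\<^esub> n' = \<zero>\<^bsub>M\<^esub>"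
    using F.smult_fps_X_power_eq_zero[of "el 0 1 \<odot>\<^bsub>M\<^esub> n'" k] n(3) n'M by simp
  have "\<phi> \<zero>\<^bsub>M\<^esub> = 0"
    using mod_homD(3)[OF \<phi>(1), of 0 "\<zero>\<^bsub>M\<^esub>"] by (simp add: self_module_def)
  then show ?thesis
    using mod_hom_value_in_tau[OF functional_induces_mod_hom[OF M \<phi>(1)] n'M] y \<phi>(2) by simp
qed

theorem tau_MCM_eq: "tau_MCM R = Idl {el 0 1}"
proof
  show "tau_MCM R \<subseteq> Idl {el 0 1}"
    using tau_MCM_subset_tau[OF MCM_mod_y] tau_mod_y by blast
  have "Idl {el 0 1} \<subseteq> tau R M" if "MCM_module R M" for M :: "('r, 'r list) module"
    using MCM_y_in_tau[OF that] by (intro genideal_minimal[OF tau_ideal]) simp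
  moreover have "Idl {el 0 1} \<subseteq> carrier R" unfolding genideal_y by auto
  ultimately show "Idl {el 0 1} \<subseteq> tau_MCM R" unfolding tau_MCM_def by blast
qed

end

section \<open>Presentation of the quotient ring\<close>

lemma genideal_y_squared:
  "Idl\<^bsub>power_series_xy\<^esub> {y_var [^]\<^bsub>power_series_xy\<^esub> (2::nat)} =
    {f :: 'k::field fps fps. fps_nth f 0 = 0 \<and> fps_nth f 1 = 0}"
proof -
  define S :: "'k fps fps ring" where "S = power_series_xy"
  interpret S: cring S unfolding S_def power_series_xy_def by (rule cring_from_type_algebra)
  have S_simps: "carrier S = UNIV" "f \<otimes>\<^bsub>S\<^esub> g = f * g" for f g
    by (simp_all add: S_def power_series_xy_def ring_of_type_algebra_def)
  have "y_var [^]\<^bsub>S\<^esub> (2::nat) = (fps_X ^ 2 :: 'k fps fps)"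
    using S.nat_pow_Suc[of y_var 1] S.nat_pow_Suc[of y_var 0] S.nat_pow_0[of y_var] S.l_one[of y_var]
    by (simp add: S_simps y_var_def numeral_2_eq_2)
  moreover have "f \<in> PIdl\<^bsub>S\<^esub> (fps_X ^ 2) \<longleftrightarrow> fps_nth f 0 = 0 \<and> fps_nth f 1 = 0" for f
  proof
    assume "f \<in> PIdl\<^bsub>S\<^esub> (fps_X ^ 2)"
    then obtain g where "f = g * fps_X ^ 2" unfolding cgenideal_def by (auto simp: S_simps)
    then show "fps_nth f 0 = 0 \<and> fps_nth f 1 = 0" by (simp add: fps_X_power_mult_right_nth)
  next
    assume f: "fps_nth f 0 = 0 \<and> fps_nth f 1 = 0"
    have "fps_nth f n = fps_nth (fps_shift 2 f * fps_X ^ 2) n" for n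
    proof (cases "n < 2")
      case False
      then have "Suc (Suc (n - 2)) = n" by simp
      then show ?thesis using False by (simp add: fps_X_power_mult_right_nth)
    qed (use f in \<open>auto simp: fps_X_power_mult_right_nth less_2_cases_iff\<close>)
    then have "f = fps_shift 2 f * fps_X ^ 2" by (rule fps_ext)
    then show "f \<in> PIdl\<^bsub>S\<^esub> (fps_X ^ 2)" unfolding cgenideal_def by (auto simp: S_simps)
  qed
  ultimately show ?thesis
    using S.cgenideal_eq_genideal[of "fps_X ^ 2"] unfolding S_def[symmetric] by (auto simp: S_simps)
qed

theorem proposition5p3:
  fixes S :: "'k::field fps fps ring" and R :: "'k fps fps set ring"
    and y :: "'k fps fps set"
  assumes "perfect_field TYPE('k)"
    and "S = power_series_xy"
    and "R = S Quot (Idl\<^bsub>S\<^esub> {y_var [^]\<^bsub>S\<^esub> (2::nat)})"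
    and "y = Idl\<^bsub>S\<^esub> {y_var [^]\<^bsub>S\<^esub> (2::nat)} +>\<^bsub>S\<^esub> y_var"
  shows "tau_MCM R = Idl\<^bsub>R\<^esub> {y}"
proof -
  define I where "I = Idl\<^bsub>S\<^esub> {y_var [^]\<^bsub>S\<^esub> (2::nat)}"
  have S_simps: "carrier S = UNIV" "f \<otimes>\<^bsub>S\<^esub> g = f * g" "f \<oplus>\<^bsub>S\<^esub> g = f + g" "\<one>\<^bsub>S\<^esub> = 1" for f g
    by (simp_all add: assms(2) power_series_xy_def ring_of_type_algebra_def)
  interpret S: cring S unfolding assms(2) power_series_xy_def by (rule cring_from_type_algebra)
  have I: "I = {f. fps_nth f 0 = 0 \<and> fps_nth f 1 = 0}"
    unfolding I_def assms(2) by (rule genideal_y_squared)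
  interpret I: ideal I S unfolding I_def by (rule S.genideal_ideal) (simp add: S_simps)
  have R: "R = S Quot I" unfolding I_def by (rule assms(3))
  interpret R: cring R unfolding R by (rule I.quotient_is_cring[OF S.is_cring])
  \<comment> \<open>A coset is determined by the coefficients of \<open>1\<close> and \<open>y\<close> of its elements.\<close>
  have coset_eq: "I +>\<^bsub>S\<^esub> f = {g. fps_nth g 0 = fps_nth f 0 \<and> fps_nth g 1 = fps_nth f 1}" for f
  proof (intro equalityI subsetI)
    fix g assume "g \<in> {g. fps_nth g 0 = fps_nth f 0 \<and> fps_nth g 1 = fps_nth f 1}"
    then have "g - f \<in> I" by (simp add: I)
    then show "g \<in> I +>\<^bsub>S\<^esub> f" unfolding a_r_coset_def' by (force simp: S_simps)
  qed (auto simp: a_r_coset_def' S_simps I)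
  have coset_eq_iff: "I +>\<^bsub>S\<^esub> f = I +>\<^bsub>S\<^esub> g \<longleftrightarrow> fps_nth f 0 = fps_nth g 0 \<and> fps_nth f 1 = fps_nth g 1"
    for f g unfolding coset_eq by auto
  define rep :: "'k fps \<Rightarrow> 'k fps \<Rightarrow> 'k fps fps" where "rep a b = fps_const a + fps_const b * fps_X" for a b
  have rep: "fps_nth (rep a b) 0 = a" "fps_nth (rep a b) 1 = b" "fps_nth (rep a b) (Suc 0) = b" for a b
    by (simp_all add: rep_def)
  define el where "el a b = I +>\<^bsub>S\<^esub> rep a b" for a b
  interpret dual_fps_ring R el
  proof unfold_locales
    show "r \<in> carrier R \<longleftrightarrow> (\<exists>a b. r = el a b)" for r
    proof
      assume "r \<in> carrier R"
      then obtain f where "r = I +>\<^bsub>S\<^esub> f" by (auto simp: R FactRing_def A_RCOSETS_def')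
      then have "r = el (fps_nth f 0) (fps_nth f 1)" by (simp add: el_def coset_eq_iff rep)
      then show "\<exists>a b. r = el a b" by blast
    qed (auto simp: R FactRing_def A_RCOSETS_def' el_def S_simps)
    show "el a b = el c d \<longleftrightarrow> a = c \<and> b = d" for a b c d
      by (simp add: el_def coset_eq_iff rep)
    have "el a b \<oplus>\<^bsub>R\<^esub> el c d = I +>\<^bsub>S\<^esub> (rep a b + rep c d)" for a b c d
      using I.a_rcos_sum[of "rep a b" "rep c d"] by (simp add: R FactRing_def el_def S_simps)
    then show "el a b \<oplus>\<^bsub>R\<^esub> el c d = el (a + c) (b + d)" for a b c d
      by (simp add: el_def coset_eq_iff rep)
    have "el a b \<otimes>\<^bsub>R\<^esub> el c d = I +>\<^bsub>S\<^esub> (rep a b * rep c d)" for a b c d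
      using I.rcoset_mult_add[of "rep a b" "rep c d"] by (simp add: R FactRing_def el_def S_simps)
    moreover have "fps_nth (rep a b * rep c d) 0 = a * c"
      "fps_nth (rep a b * rep c d) 1 = a * d + b * c" for a b c d
      using rep by (simp_all add: fps_mult_nth)
    ultimately show "el a b \<otimes>\<^bsub>R\<^esub> el c d = el (a * c) (a * d + b * c)" for a b c d
      by (simp add: el_def coset_eq_iff rep)
    show "\<one>\<^bsub>R\<^esub> = el 1 0"
      by (simp add: R FactRing_def el_def S_simps coset_eq_iff rep)
  qed
  have "y = el 0 1" unfolding assms(4) I_def[symmetric] el_def coset_eq_iff by (simp add: rep y_var_def)
  then show ?thesis using tau_MCM_eq by simp
qed

end
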